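(* Let $\mathcal H$ be a complex Hilbert space, let $I$ be the identity operator on a complex Hilbert space $\mathcal L$, and let $I_2$ be the identity operator on $\mathbb C^2$. The distance constant of $\mathbb CI\otimes\mathcal B(\mathcal H)\subset\mathcal B(\mathcal L\otimes\mathcal H)$ is at most $2$. The distance constant of $\mathbb CI_2\otimes\mathcal B(\mathcal H)\subset\mathcal B(\mathbb C^2\otimes\mathcal H)$ is at most $\frac32$.
   Context: For a linear subspace $\mathcal S\subset\mathcal B(\mathcal H')$ ($\mathcal H'$ a Hilbert space) and $x\in\mathcal H'$, $P_{\mathcal Sx}$ is the orthogonal projection onto $\overline{\mathcal Sx}$, and $\beta_{\mathcal S}(T)=\sup_{\|x\|=1}\|P_{\mathcal Sx}^\perp Tx\|$. The distance constant $\kappa_{\mathcal S}$ is the least $C\ge1$ with $\operatorname{dist}(T,\mathcal S)\le C\,\beta_{\mathcal S}(T)$ for all $T\in\mathcal B(\mathcal H')$. (For a unital algebra $\mathfrak A$, $\beta_{\mathfrak A}(T)=\sup\{\|P^\perp TP\|:P\in\operatorname{Lat}\mathfrak A\}$.) Here $\mathbb CI\otimes\mathcal B(\mathcal H)=\{I\otimes A:A\in\mathcal B(\mathcal H)\}$. *)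

theory Defs
  imports "HOL-Analysis.Analysis"
begin

text \<open>Complex inner product spaces. The inner product is conjugate-linear in its first and linear
  in its second argument. The real vector space structure, the norm and the topology are those of
  the superclass, tied to the complex structure by the axioms.\<close>

class complex_inner = real_normed_vector +
  fixes scaleC :: "complex \<Rightarrow> 'a \<Rightarrow> 'a" (infixr \<open>*\<^sub>C\<close> 75)
    and cinner :: "'a \<Rightarrow> 'a \<Rightarrow> complex"
  assumes scaleC_add_right: "c *\<^sub>C (x + y) = c *\<^sub>C x + c *\<^sub>C y"
    and scaleC_add_left: "(c + d) *\<^sub>C x = c *\<^sub>C x + d *\<^sub>C x"
    and scaleC_scaleC: "c *\<^sub>C d *\<^sub>C x = (c * d) *\<^sub>C x"
    and scaleC_one: "1 *\<^sub>C x = x"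
    and scaleR_scaleC: "r *\<^sub>R x = complex_of_real r *\<^sub>C x"
    and cinner_commute: "cinner x y = cnj (cinner y x)"
    and cinner_add_right: "cinner x (y + z) = cinner x y + cinner x z"
    and cinner_scaleC_right: "cinner x (c *\<^sub>C y) = c * cinner x y"
    and cinner_ge_zero: "0 \<le> Re (cinner x x)"
    and norm_eq_sqrt_cinner: "norm x = sqrt (Re (cinner x x))"

class chilbert_space = complex_inner + complete_space

global_interpretation complex_vector: vector_space "scaleC :: complex \<Rightarrow> 'a \<Rightarrow> 'a::complex_inner"
  defines cspan = complex_vector.span
  by unfold_locales
    (simp_all add: scaleC_add_right scaleC_add_left scaleC_scaleC scaleC_one)

instantiation complex :: chilbert_space
begin

definition scaleC_complex :: "complex \<Rightarrow> complex \<Rightarrow> complex"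
  where "scaleC_complex c x = c * x"

definition cinner_complex :: "complex \<Rightarrow> complex \<Rightarrow> complex"
  where "cinner_complex x y = cnj x * y"

instance
  by standard
    (auto simp: scaleC_complex_def cinner_complex_def algebra_simps scaleR_conv_of_real
      cmod_def power2_eq_square)

end

instantiation vec :: (complex_inner, finite) complex_inner
begin

definition scaleC_vec :: "complex \<Rightarrow> 'a ^ 'b \<Rightarrow> 'a ^ 'b"
  where "scaleC_vec c x = (\<chi> i. c *\<^sub>C (x $ i))"

definition cinner_vec :: "'a ^ 'b \<Rightarrow> 'a ^ 'b \<Rightarrow> complex"
  where "cinner_vec x y = (\<Sum>i\<in>UNIV. cinner (x $ i) (y $ i))"

instance
proof
  fix x y z :: "'a ^ 'b" and c d :: complex and r :: real
  show "c *\<^sub>C (x + y) = c *\<^sub>C x + c *\<^sub>C y"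
    by (simp add: scaleC_vec_def vec_eq_iff scaleC_add_right)
  show "(c + d) *\<^sub>C x = c *\<^sub>C x + d *\<^sub>C x"
    by (simp add: scaleC_vec_def vec_eq_iff scaleC_add_left)
  show "c *\<^sub>C d *\<^sub>C x = (c * d) *\<^sub>C x"
    by (simp add: scaleC_vec_def vec_eq_iff scaleC_scaleC)
  show "1 *\<^sub>C x = x"
    by (simp add: scaleC_vec_def vec_eq_iff scaleC_one)
  show "r *\<^sub>R x = complex_of_real r *\<^sub>C x"
    by (simp add: scaleC_vec_def vec_eq_iff scaleR_scaleC)
  show "cinner x y = cnj (cinner y x)"
    unfolding cinner_vec_def cnj_sum by (intro sum.cong refl cinner_commute)
  show "cinner x (y + z) = cinner x y + cinner x z"
    by (simp add: cinner_vec_def cinner_add_right sum.distrib)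
  show "cinner x (c *\<^sub>C y) = c * cinner x y"
    by (simp add: cinner_vec_def scaleC_vec_def cinner_scaleC_right sum_distrib_left)
  show "0 \<le> Re (cinner x x)"
    by (simp add: cinner_vec_def Re_sum sum_nonneg cinner_ge_zero)
  show "norm x = sqrt (Re (cinner x x))"
    by (simp add: cinner_vec_def Re_sum norm_vec_def L2_set_def norm_eq_sqrt_cinner cinner_ge_zero)
qed

end

instance vec :: (chilbert_space, finite) chilbert_space ..

text \<open>\<open>\<B>(\<H>)\<close>: the type of bounded real-linear maps is cut down to the complex-linear ones; its norm
  is the operator norm.\<close>

definition bounded_ops :: "('a::complex_inner \<Rightarrow>\<^sub>L 'a) set"
  where "bounded_ops = {T. \<forall>c x. blinfun_apply T (c *\<^sub>C x) = c *\<^sub>C blinfun_apply T x}"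

text \<open>The orthogonal projection onto \<open>M\<close>, well defined if \<open>M\<close> is a closed complex subspace of
  a Hilbert space.\<close>

definition orth_proj :: "'a::complex_inner set \<Rightarrow> 'a \<Rightarrow> 'a"
  where "orth_proj M y = (THE m. m \<in> M \<and> (\<forall>z\<in>M. cinner z (y - m) = 0))"

definition orbit_closure :: "('a::complex_inner \<Rightarrow>\<^sub>L 'a) set \<Rightarrow> 'a \<Rightarrow> 'a set"
  where "orbit_closure S x = closure ((\<lambda>A. blinfun_apply A x) ` S)"

text \<open>The supremum is taken in \<^typ>\<open>ennreal\<close>, so that it is \<open>0\<close> on the zero space, where there are no
  unit vectors.\<close>

definition dist_beta :: "('a::complex_inner \<Rightarrow>\<^sub>L 'a) set \<Rightarrow> ('a \<Rightarrow>\<^sub>L 'a) \<Rightarrow> ennreal"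
  where "dist_beta S T =
    (SUP x\<in>{x. norm x = 1}.
      ennreal (norm (blinfun_apply T x - orth_proj (orbit_closure S x) (blinfun_apply T x))))"

text \<open>The value is \<open>\<infinity>\<close> if no constant exists; otherwise the infimum is attained, see below.\<close>

definition distance_constant :: "('a::complex_inner \<Rightarrow>\<^sub>L 'a) set \<Rightarrow> ennreal"
  where "distance_constant S =
    Inf (ennreal ` {C. 1 \<le> C \<and>
      (\<forall>T\<in>bounded_ops. ennreal (infdist T S) \<le> ennreal C * dist_beta S T)})"

lemma distance_constant_least:
  assumes "distance_constant S < \<infinity>"
  obtains C where "distance_constant S = ennreal C" and "1 \<le> C"
    and "\<And>T. T \<in> bounded_ops \<Longrightarrow> ennreal (infdist T S) \<le> ennreal C * dist_beta S T"
    and "\<And>D. 1 \<le> D \<Longrightarrow>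
      (\<And>T. T \<in> bounded_ops \<Longrightarrow> ennreal (infdist T S) \<le> ennreal D * dist_beta S T) \<Longrightarrow> C \<le> D"
proof -
  define X where "X = {C. 1 \<le> C \<and>
      (\<forall>T\<in>bounded_ops. ennreal (infdist T S) \<le> ennreal C * dist_beta S T)}"
  have dc: "distance_constant S = Inf (ennreal ` X)"
    by (simp add: distance_constant_def X_def)
  obtain C where C: "distance_constant S = ennreal C" "0 \<le> C"
    using assms by (cases "distance_constant S") auto
  have "1 \<le> Inf (ennreal ` X)"
    by (intro Inf_greatest) (auto simp: X_def)
  then have C1: "1 \<le> C"
    using C dc by simp
  have le: "ennreal (infdist T S) \<le> ennreal C * dist_beta S T" if T: "T \<in> bounded_ops" for T
  proof (cases "dist_beta S T")
    case top
    then show ?thesis using C1 by (simp add: ennreal_mult_top)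
  next
    case (real b)
    show ?thesis
    proof (cases "b = 0")
      case True
      have "X \<noteq> {}" using assms dc by auto
      then obtain D where "D \<in> X" by auto
      then have "ennreal (infdist T S) \<le> ennreal D * dist_beta S T"
        using T by (auto simp: X_def)
      then show ?thesis using True real by simp
    next
      case False
      then have b: "b > 0" using real by simp
      have "ennreal (infdist T S / b) \<le> Inf (ennreal ` X)"
      proof (rule Inf_greatest, clarify)
        fix D assume "D \<in> X"
        then have D: "1 \<le> D" "ennreal (infdist T S) \<le> ennreal D * dist_beta S T"
          using T by (auto simp: X_def)
        then have "infdist T S \<le> D * b"
          using real b by (simp add: ennreal_mult[symmetric])
        then show "ennreal (infdist T S / b) \<le> ennreal D"
          using b D(1) by (intro ennreal_leI) (simp add: field_simps)
      qed
      then have "infdist T S / b \<le> C"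
        using C dc by simp
      then have "infdist T S \<le> C * b"
        using b by (simp add: field_simps)
      then show ?thesis
        using real b C by (simp add: ennreal_mult[symmetric] ennreal_leI)
    qed
  qed
  have least: "C \<le> D" if "1 \<le> D"
    "\<And>T. T \<in> bounded_ops \<Longrightarrow> ennreal (infdist T S) \<le> ennreal D * dist_beta S T" for D
  proof -
    have "Inf (ennreal ` X) \<le> ennreal D"
      using that by (intro Inf_lower) (auto simp: X_def)
    then show ?thesis
      using C dc that(1) by simp
  qed
  show ?thesis
    by (rule that[OF C(1) C1 le least])
qed

text \<open>\<open>t\<close> exhibits the Hilbert space \<open>'k\<close> as the Hilbert space tensor product of \<open>'l\<close> and \<open>'h\<close>, with
  \<open>t x y\<close> as \<open>x \<otimes> y\<close>. This determines \<open>('k, t)\<close> up to a unique unitary.\<close>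

definition hilbert_tensor ::
    "('l::chilbert_space \<Rightarrow> 'h::chilbert_space \<Rightarrow> 'k::chilbert_space) \<Rightarrow> bool"
  where "hilbert_tensor t \<longleftrightarrow>
    (\<forall>x x' y. t (x + x') y = t x y + t x' y) \<and>
    (\<forall>x y y'. t x (y + y') = t x y + t x y') \<and>
    (\<forall>c x y. t (c *\<^sub>C x) y = c *\<^sub>C t x y) \<and>
    (\<forall>c x y. t x (c *\<^sub>C y) = c *\<^sub>C t x y) \<and>
    (\<forall>x x' y y'. cinner (t x y) (t x' y') = cinner x x' * cinner y y') \<and>
    closure (cspan {t x y |x y. True}) = UNIV"

lemma hilbert_tensor_vec:
  "hilbert_tensor (\<lambda>(v :: complex ^ 'n) (h :: 'h::chilbert_space). (\<chi> i. v $ i *\<^sub>C h) :: 'h ^ 'n)"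
    (is "hilbert_tensor ?t")
proof -
  have "x \<in> cspan {?t v h |v h. True}" for x :: "'h ^ 'n"
  proof -
    have [simp]: "0 *\<^sub>C h = 0" for h :: 'h
      using complex_vector.scale_zero_left[of h] .
    have "x $ j = (\<Sum>i\<in>UNIV. ?t (axis i 1) (x $ i)) $ j" for j
    proof -
      have "(\<Sum>i\<in>UNIV. ?t (axis i 1) (x $ i)) $ j = (\<Sum>i\<in>UNIV. if i = j then x $ i else 0)"
        unfolding sum_component by (intro sum.cong) (auto simp: axis_def scaleC_one)
      then show ?thesis by simp
    qed
    then have "x = (\<Sum>i\<in>UNIV. ?t (axis i 1) (x $ i))"
      unfolding vec_eq_iff by blast
    also have "\<dots> \<in> cspan {?t v h |v h. True}"
      by (intro complex_vector.span_sum complex_vector.span_base) blast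
    finally show ?thesis .
  qed
  then have "cspan {?t v h |v h. True} = UNIV" by blast
  moreover have "cinner (a *\<^sub>C h) (b *\<^sub>C h') = cnj a * b * cinner h h'" for a b and h h' :: 'h
    by (metis cinner_commute cinner_scaleC_right complex_cnj_mult complex_cnj_cnj mult.assoc
        mult.left_commute)
  ultimately show ?thesis
    unfolding hilbert_tensor_def
    by (auto simp: vec_eq_iff scaleC_vec_def cinner_vec_def cinner_complex_def scaleC_complex_def
        scaleC_add_left scaleC_add_right scaleC_scaleC mult.commute sum_distrib_left)
qed

text \<open>\<open>A \<otimes> B\<close>; for \<open>hilbert_tensor t\<close> and complex-linear \<open>A\<close>, \<open>B\<close> there is exactly one such \<open>R\<close>.\<close>

definition tensor_op ::
    "('l::chilbert_space \<Rightarrow> 'h::chilbert_space \<Rightarrow> 'k::chilbert_space) \<Rightarrow>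
      ('l \<Rightarrow>\<^sub>L 'l) \<Rightarrow> ('h \<Rightarrow>\<^sub>L 'h) \<Rightarrow> ('k \<Rightarrow>\<^sub>L 'k)"
  where "tensor_op t A B =
    (THE R. R \<in> bounded_ops \<and>
      (\<forall>x y. blinfun_apply R (t x y) = t (blinfun_apply A x) (blinfun_apply B y)))"

text \<open>\<open>\<complex>I \<otimes> \<B>(\<H>)\<close> = \<open>{I \<otimes> A | A \<in> \<B>(\<H>)}\<close>, where \<open>I\<close> is the identity on the first factor.\<close>

definition scalar_tensor_ops ::
    "('l::chilbert_space \<Rightarrow> 'h::chilbert_space \<Rightarrow> 'k::chilbert_space) \<Rightarrow> ('k \<Rightarrow>\<^sub>L 'k) set"
  where "scalar_tensor_ops t = {tensor_op t id_blinfun A |A. A \<in> bounded_ops}"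

end

theory Submission
  imports Defs
begin

text \<open>For orthonormal \<open>e\<^sub>0, \<dots>, e\<^bsub>n - 1\<^esub>\<close> in the first factor there are \<open>n\<^sup>2\<close> self-adjoint unitary matrices
  \<open>U\<close> for which the average of \<open>(U \<otimes> I) T (U \<otimes> I)\<close> is \<open>I \<otimes> A\<close>, where \<open>A\<close> is the mean of the diagonal
  blocks of \<open>T\<close>. If \<open>P\<close>, \<open>Q\<close> are the spectral projections of \<open>U \<otimes> I\<close>, then
  \<open>T - (U \<otimes> I) T (U \<otimes> I) = 2 (P T Q + Q T P)\<close> has norm at most \<open>2 \<beta>(T)\<close>, hence so has \<open>T - I \<otimes> A\<close>.
  For \<open>n = 2\<close> the unitaries are the four Pauli matrices, the identity among them contributes nothing,
  and the bound becomes \<open>3/4 \<cdot> 2 \<beta>(T)\<close>. The general case follows from the compressions of \<open>T\<close> to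
  finite-dimensional subspaces of the first factor by weak operator compactness.\<close>

section \<open>Complex Hilbert spaces\<close>

lemma cinner_add_left: "cinner (x + y) z = cinner x z + cinner y (z::'a::complex_inner)"
  by (metis cinner_commute cinner_add_right complex_cnj_add)

lemma cinner_scaleC_left: "cinner (c *\<^sub>C x) y = cnj c * cinner x (y::'a::complex_inner)"
  by (metis cinner_commute cinner_scaleC_right complex_cnj_mult)

lemma cinner_self: "cinner x x = complex_of_real ((norm (x::'a::complex_inner))\<^sup>2)"
proof -
  have "Im (cinner x x) = 0"
    using cinner_commute[of x x] by (metis complex_cnj_cancel_iff cnj.simps(2) equal_neg_zero)
  moreover have "Re (cinner x x) = (norm x)\<^sup>2"
    by (simp add: norm_eq_sqrt_cinner cinner_ge_zero)
  ultimately show ?thesis by (simp add: complex_eq_iff)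
qed

lemma norm_scaleC: "norm (c *\<^sub>C (x::'a::complex_inner)) = cmod c * norm x"
proof -
  have "complex_of_real ((norm (c *\<^sub>C x))\<^sup>2) = (c * cnj c) * complex_of_real ((norm x)\<^sup>2)"
    by (simp only: cinner_self[symmetric] cinner_scaleC_left cinner_scaleC_right mult_ac)
  also have "\<dots> = complex_of_real ((cmod c * norm x)\<^sup>2)"
    by (simp add: complex_norm_square[symmetric] power_mult_distrib)
  finally have "(norm (c *\<^sub>C x))\<^sup>2 = (cmod c * norm x)\<^sup>2"
    using of_real_eq_iff by blast
  then show ?thesis
    by (simp add: power2_eq_iff_nonneg)
qed

lemma norm_add_square:
  "(norm (x + y))\<^sup>2 = (norm x)\<^sup>2 + 2 * Re (cinner x y) + (norm (y::'a::complex_inner))\<^sup>2"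
proof -
  have "complex_of_real ((norm (x + y))\<^sup>2) = cinner x x + (cinner x y + cnj (cinner x y)) + cinner y y"
    by (simp only: cinner_self[symmetric] cinner_add_left cinner_add_right cinner_commute[of y x])
      simp
  also have "\<dots> = complex_of_real ((norm x)\<^sup>2 + 2 * Re (cinner x y) + (norm y)\<^sup>2)"
    by (simp add: cinner_self complex_add_cnj)
  finally show ?thesis using of_real_eq_iff by blast
qed

text \<open>Expand the nonnegative square of the norm of \<open>y + c *\<^sub>C x\<close> for the
  \<open>c\<close> that makes this vector orthogonal to \<open>x\<close>.\<close>

lemma cauchy_schwarz: "cmod (cinner x y) \<le> norm x * norm (y::'a::complex_inner)"
proof (cases "x = 0")
  case True
  have "cinner 0 y = 0"
    using cinner_scaleC_left[of 0 0 y] by simp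
  then show ?thesis using True by simp
next
  case False
  define c where "c = - cinner x y / complex_of_real ((norm x)\<^sup>2)"
  have nz: "complex_of_real ((norm x)\<^sup>2) \<noteq> 0" using False by simp
  have "0 \<le> (norm (y + c *\<^sub>C x))\<^sup>2" by simp
  also have "\<dots> = (norm y)\<^sup>2 + 2 * Re (c * cnj (cinner x y)) + (cmod c)\<^sup>2 * (norm x)\<^sup>2"
    by (simp add: norm_add_square cinner_scaleC_right norm_scaleC power_mult_distrib
        cinner_commute[of y x])
  also have "c * cnj (cinner x y) = complex_of_real (- (cmod (cinner x y))\<^sup>2 / (norm x)\<^sup>2)"
    by (simp add: c_def complex_norm_square[symmetric])
  also have "(cmod c)\<^sup>2 * (norm x)\<^sup>2 = (cmod (cinner x y))\<^sup>2 / (norm x)\<^sup>2"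
    using False by (simp add: c_def norm_divide norm_power power_divide field_simps power2_eq_square norm_mult)
  finally have "(cmod (cinner x y))\<^sup>2 / (norm x)\<^sup>2 \<le> (norm y)\<^sup>2" by simp
  then have "(cmod (cinner x y))\<^sup>2 \<le> (norm x * norm y)\<^sup>2"
    using False by (simp add: field_simps power_mult_distrib)
  then show ?thesis
    by (meson mult_nonneg_nonneg norm_ge_zero power2_le_imp_le)
qed

interpretation cinner: bounded_bilinear "cinner :: 'a::complex_inner \<Rightarrow> 'a \<Rightarrow> complex"
proof
  show "\<exists>K. \<forall>a b. norm (cinner (a::'a) b) \<le> norm a * norm b * K"
    by (metis cauchy_schwarz mult.right_neutral)
qed (simp_all add: cinner_add_left cinner_add_right cinner_scaleC_left cinner_scaleC_right
      scaleR_scaleC scaleC_complex_def)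

lemma cinner_eqI:
  assumes "\<And>h. cinner h x = cinner h y"
  shows "x = (y::'a::complex_inner)"
proof -
  have "cinner (x - y) (x - y) = 0"
    by (simp add: cinner.diff_right assms)
  then show ?thesis by (simp add: cinner_self)
qed

section \<open>Orthogonal projections and the Riesz representation\<close>

lemma parallelogram:
  "(norm (x + y))\<^sup>2 + (norm (x - y))\<^sup>2 = 2 * (norm x)\<^sup>2 + 2 * (norm (y::'a::complex_inner))\<^sup>2"
  using norm_add_square[of x y] norm_add_square[of x "- y"] by (simp add: cinner.minus_right)

text \<open>A minimizing sequence is Cauchy: midpoints of its members stay in \<open>M\<close>, at
  distance at least \<open>d\<close> from \<open>y\<close>, and the parallelogram law then bounds
  the differences of the members.\<close>

lemma closest_point_exists:
  fixes M :: "'a::chilbert_space set"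
  assumes M: "complex_vector.subspace M" and cl: "closed M"
  obtains m where "m \<in> M" and "\<And>z. z \<in> M \<Longrightarrow> norm (y - m) \<le> norm (y - z)"
proof -
  have ne: "M \<noteq> {}" using M complex_vector.subspace_0 by blast
  define d where "d = infdist y M"
  have d: "d \<le> norm (y - z)" if "z \<in> M" for z
    using infdist_le[OF that, of y] by (simp add: d_def dist_norm)
  have d0: "0 \<le> d" by (simp add: d_def infdist_nonneg)
  have "\<exists>m\<in>M. norm (y - m) < d + e" if "e > 0" for e
  proof (rule ccontr)
    assume "\<not> ?thesis"
    then have "d + e \<le> infdist y M"
      by (auto simp: infdist_def ne dist_norm not_less intro!: cINF_greatest)
    then show False using that by (simp add: d_def)
  qed
  then have "\<forall>n. \<exists>m\<in>M. norm (y - m) < d + 1 / real (Suc n)" by simp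
  then obtain m where m: "m n \<in> M" "norm (y - m n) < d + 1 / real (Suc n)" for n
    by metis
  have mid: "(norm (m i - m j))\<^sup>2 \<le> 2 * (norm (y - m i))\<^sup>2 + 2 * (norm (y - m j))\<^sup>2 - 4 * d\<^sup>2" for i j
  proof -
    have "(1/2) *\<^sub>R (m i + m j) \<in> M"
      by (simp add: scaleR_scaleC M m complex_vector.subspace_scale complex_vector.subspace_add)
    then have "d \<le> norm (y - (1/2) *\<^sub>R (m i + m j))" by (rule d)
    also have "\<dots> = norm ((1/2) *\<^sub>R ((y - m i) + (y - m j)))"
      by (rule arg_cong[of _ _ norm]) (simp add: algebra_simps flip: scaleR_left.add)
    finally have "2 * d \<le> norm ((y - m i) + (y - m j))" by simp
    then have "(2 * d)\<^sup>2 \<le> (norm ((y - m i) + (y - m j)))\<^sup>2"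
      using d0 by (intro power_mono) auto
    moreover have "norm ((y - m i) - (y - m j)) = norm (m i - m j)"
      by (simp add: norm_minus_commute)
    ultimately show ?thesis
      using parallelogram[of "y - m i" "y - m j"] by (simp add: power_mult_distrib)
  qed
  have lim: "(\<lambda>n. norm (y - m n)) \<longlonglongrightarrow> d"
  proof (rule tendsto_sandwich[of "\<lambda>_. d" _ _ "\<lambda>n. d + 1 / real (Suc n)"])
    show "(\<lambda>n. d + 1 / real (Suc n)) \<longlonglongrightarrow> d"
      using tendsto_add[OF tendsto_const[of d] LIMSEQ_Suc[OF lim_1_over_n]] by simp
  qed (use d m less_imp_le in \<open>blast intro: always_eventually\<close>)+
  have "Cauchy m"
  proof (rule metric_CauchyI)
    fix e :: real assume e: "e > 0"
    have "(\<lambda>n. (norm (y - m n))\<^sup>2) \<longlonglongrightarrow> d\<^sup>2"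
      using lim by (rule tendsto_power)
    then have "\<forall>\<^sub>F n in sequentially. (norm (y - m n))\<^sup>2 < d\<^sup>2 + e\<^sup>2 / 4"
      by (rule order_tendstoD(2)) (use e in simp)
    then obtain N where N: "\<And>n. n \<ge> N \<Longrightarrow> (norm (y - m n))\<^sup>2 < d\<^sup>2 + e\<^sup>2 / 4"
      by (auto simp: eventually_sequentially)
    show "\<exists>N. \<forall>i\<ge>N. \<forall>j\<ge>N. dist (m i) (m j) < e"
    proof (intro exI[of _ N] allI impI)
      fix i j assume "i \<ge> N" "j \<ge> N"
      then have "(norm (m i - m j))\<^sup>2 < e\<^sup>2"
        using N[of i] N[of j] mid[of i j] by linarith
      then show "dist (m i) (m j) < e"
        using e by (simp add: dist_norm power2_less_imp_less)
    qed
  qed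
  then obtain l where l: "m \<longlonglongrightarrow> l"
    using Cauchy_convergent convergent_def by blast
  have "l \<in> M"
    using closed_sequentially[OF cl _ l] m by blast
  moreover have "norm (y - l) = d"
    using LIMSEQ_unique[OF tendsto_norm[OF tendsto_diff[OF tendsto_const l]] lim] .
  ultimately show ?thesis using that d by metis
qed

text \<open>If some \<open>z\<close> in \<open>M\<close> were not orthogonal to
  \<open>y - m\<close>, moving the closest point \<open>m\<close> by the component of
  \<open>y - m\<close> along \<open>z\<close> would bring it closer to \<open>y\<close>.\<close>

lemma orthogonal_projection_exists:
  fixes M :: "'a::chilbert_space set"
  assumes M: "complex_vector.subspace M" and cl: "closed M"
  obtains m where "m \<in> M" and "\<And>z. z \<in> M \<Longrightarrow> cinner z (y - m) = 0"
proof -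
  obtain m where m: "m \<in> M" "\<And>z. z \<in> M \<Longrightarrow> norm (y - m) \<le> norm (y - z)"
    using closest_point_exists[OF M cl] by blast
  have "cinner z (y - m) = 0" if z: "z \<in> M" for z
  proof (rule ccontr)
    define v where "v = cinner z (y - m)"
    assume "cinner z (y - m) \<noteq> 0"
    then have v: "v \<noteq> 0" and z0: "norm z \<noteq> 0" by (auto simp: v_def cinner.zero_left)
    define c where "c = v / complex_of_real ((norm z)\<^sup>2)"
    have "m + c *\<^sub>C z \<in> M"
      by (simp add: M m z complex_vector.subspace_scale complex_vector.subspace_add)
    from m(2)[OF this] have "(norm (y - m))\<^sup>2 \<le> (norm ((y - m) + (- c) *\<^sub>C z))\<^sup>2"
      by (intro power_mono) (auto simp: algebra_simps)
    also have "\<dots> = (norm (y - m))\<^sup>2 - 2 * Re (c * cnj v) + (cmod c)\<^sup>2 * (norm z)\<^sup>2"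
      unfolding norm_add_square norm_scaleC cinner_scaleC_right
      by (simp add: v_def power_mult_distrib cinner_commute[of "y - m" z])
    also have "c * cnj v = complex_of_real ((cmod v)\<^sup>2 / (norm z)\<^sup>2)"
      by (simp add: c_def complex_norm_square[symmetric])
    also have "(cmod c)\<^sup>2 * (norm z)\<^sup>2 = (cmod v)\<^sup>2 / (norm z)\<^sup>2"
      using z0 by (simp add: c_def norm_divide norm_power power_divide field_simps power2_eq_square norm_mult)
    finally have "(cmod v)\<^sup>2 / (norm z)\<^sup>2 \<le> 0" by simp
    then show False using v z0 by (simp add: divide_le_0_iff)
  qed
  then show ?thesis using that m by blast
qed

text \<open>The \<open>THE\<close> is well defined: the difference of two candidates lies in
  \<open>M\<close> and is orthogonal to itself.\<close>

lemma orth_proj_in: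
  fixes M :: "'a::chilbert_space set"
  assumes M: "complex_vector.subspace M" and cl: "closed M"
  shows "orth_proj M y \<in> M"
proof -
  obtain m where m: "m \<in> M" "\<And>z. z \<in> M \<Longrightarrow> cinner z (y - m) = 0"
    using orthogonal_projection_exists[OF M cl] by blast
  have "orth_proj M y = m"
    unfolding orth_proj_def
  proof (rule the_equality)
    fix m' assume m': "m' \<in> M \<and> (\<forall>z\<in>M. cinner z (y - m') = 0)"
    have d: "m' - m \<in> M" using M m m' complex_vector.subspace_diff by blast
    have "cinner (m' - m) ((y - m) - (y - m')) = 0"
      using m(2)[OF d] m' d by (metis cinner.diff_right diff_self)
    then show "m' = m" by (simp add: cinner_self)
  qed (use m in blast)
  then show ?thesis using m by simp
qed

text \<open>The vector is a multiple of a \<open>z\<close> orthogonal to the kernel; pairing the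
  kernel element \<open>\<phi> z *\<^sub>C x - \<phi> x *\<^sub>C z\<close> with \<open>z\<close>
  gives the factor.\<close>

lemma riesz_representation:
  fixes \<phi> :: "'a::chilbert_space \<Rightarrow> complex"
  assumes add: "\<And>x y. \<phi> (x + y) = \<phi> x + \<phi> y" and scale: "\<And>c x. \<phi> (c *\<^sub>C x) = c * \<phi> x"
    and bdd: "\<And>x. cmod (\<phi> x) \<le> C * norm x"
  obtains w where "\<And>x. \<phi> x = cinner w x"
proof (cases "\<forall>x. \<phi> x = 0")
  case True
  then show ?thesis using that[of 0] by (simp add: cinner.zero_left)
next
  case False
  then obtain x0 where x0: "\<phi> x0 \<noteq> 0" by blast
  define M where "M = {x. \<phi> x = 0}"
  have zero: "\<phi> 0 = 0" using add[of 0 0] by simp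
  have M: "complex_vector.subspace M"
    by (auto simp: complex_vector.subspace_def M_def add scale zero)
  have "bounded_linear \<phi>"
    by (rule bounded_linear_intro[of _ C])
      (simp_all add: add scaleR_scaleC scaleC_complex_def scale bdd mult.commute)
  then have "continuous_on UNIV \<phi>" by (rule linear_continuous_on)
  then have cl: "closed M"
    unfolding M_def by (intro closed_Collect_eq) auto
  have diff: "\<phi> (x - y) = \<phi> x - \<phi> y" for x y
    using add[of "x - y" y] by simp
  obtain m where m: "m \<in> M" "\<And>z. z \<in> M \<Longrightarrow> cinner z (x0 - m) = 0"
    using orthogonal_projection_exists[OF M cl] by blast
  define z where "z = x0 - m"
  have \<phi>z: "\<phi> z \<noteq> 0" using x0 m by (simp add: z_def diff M_def)
  then have z0: "norm z \<noteq> 0" using zero by auto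
  have "\<phi> x = cinner ((cnj (\<phi> z) / complex_of_real ((norm z)\<^sup>2)) *\<^sub>C z) x" for x
  proof -
    have "(\<phi> z) *\<^sub>C x - (\<phi> x) *\<^sub>C z \<in> M" by (simp add: M_def diff scale)
    then have "cinner ((\<phi> z) *\<^sub>C x - (\<phi> x) *\<^sub>C z) z = 0" using m(2) z_def by blast
    then have "cinner z ((\<phi> z) *\<^sub>C x - (\<phi> x) *\<^sub>C z) = 0"
      by (metis cinner_commute complex_cnj_zero)
    then have "\<phi> z * cinner z x = \<phi> x * complex_of_real ((norm z)\<^sup>2)"
      by (simp add: cinner.diff_right cinner_scaleC_right cinner_self)
    then show ?thesis
      using z0 by (simp add: cinner_scaleC_left field_simps)
  qed
  then show ?thesis by (rule that)
qed

text \<open>Weak operator compactness of balls: Tychonoff's theorem for the values of the forms.\<close>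

lemma bounded_forms_cluster_operator:
  fixes r :: "'i \<Rightarrow> 'a::chilbert_space \<Rightarrow> 'a \<Rightarrow> complex"
  assumes F: "F \<noteq> bot"
    and addl: "\<And>i x x' y. r i (x + x') y = r i x y + r i x' y"
    and addr: "\<And>i x y y'. r i x (y + y') = r i x y + r i x y'"
    and scalel: "\<And>i c x y. r i (c *\<^sub>C x) y = cnj c * r i x y"
    and scaler: "\<And>i c x y. r i x (c *\<^sub>C y) = c * r i x y"
    and bdd: "\<And>i x y. cmod (r i x y) \<le> C * norm x * norm y"
  obtains R G where "R \<in> bounded_ops" and "G \<noteq> bot" and "G \<le> F"
    and "\<And>x y. ((\<lambda>i. r i x y) \<longlongrightarrow> cinner x (blinfun_apply R y)) G"
proof -
  \<comment> \<open>The bound depends only on the pair of arguments, so all the forms lie in one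
    compact product of discs.\<close>
  define B where "B = (\<Pi>\<^sub>E p\<in>(UNIV::('a\<times>'a) set). cball (0::complex) (C * norm (fst p) * norm (snd p)))"
  have "compactin (product_topology (\<lambda>_. euclidean) UNIV) B"
    unfolding B_def by (simp add: compactin_PiE)
  then have B: "compact B"
    by (simp add: euclidean_product_topology)
  define q where "q i = (\<lambda>p. r i (fst p) (snd p))" for i
  have "eventually (\<lambda>g. g \<in> B) (filtermap q F)"
    by (auto simp: eventually_filtermap B_def q_def bdd intro!: always_eventually)
  moreover have "filtermap q F \<noteq> bot" using F by (simp add: filtermap_bot_iff)
  ultimately obtain g where gB: "g \<in> B" and g: "inf (nhds g) (filtermap q F) \<noteq> bot"
    using B unfolding compact_filter by blast
  \<comment> \<open>Meeting \<open>F\<close> with the pulled-back neighbourhoods of the cluster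
    point \<open>g\<close> gives a nontrivial finer filter along which the values at all pairs
    converge at once.\<close>
  define G where "G = inf (filtercomap q (nhds g)) F"
  have GF: "G \<le> F" by (simp add: G_def)
  have G: "G \<noteq> bot"
  proof
    assume "G = bot"
    then have "eventually (\<lambda>_. False) G" by simp
    then obtain P Q where PQ: "eventually P (nhds g)" "eventually Q F" "\<And>i. P (q i) \<Longrightarrow> Q i \<Longrightarrow> False"
      unfolding G_def eventually_inf eventually_filtercomap by metis
    have "eventually (\<lambda>h. \<not> P h) (filtermap q F)"
      unfolding eventually_filtermap by (rule eventually_mono[OF PQ(2)]) (use PQ(3) in blast)
    then have "eventually (\<lambda>_. False) (inf (nhds g) (filtermap q F))"
      unfolding eventually_inf using PQ(1) by blast
    then show False using g by (simp add: trivial_limit_def)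
  qed
  have "filterlim q (nhds g) G"
    unfolding G_def by (rule filterlim_mono[OF filterlim_filtercomap order_refl inf_le1])
  then have lim: "((\<lambda>i. r i x y) \<longlongrightarrow> g (x, y)) G" for x y
  proof -
    assume q: "filterlim q (nhds g) G"
    show ?thesis
    proof (rule topological_tendstoI)
      fix S :: "complex set" assume S: "open S" "g (x, y) \<in> S"
      have "open ((\<lambda>h::'a \<times> 'a \<Rightarrow> complex. h (x, y)) -` S)"
        by (intro open_vimage S continuous_on_product_coordinates)
      from topological_tendstoD[OF q this] S(2) show "\<forall>\<^sub>F i in G. r i x y \<in> S"
        by (simp add: q_def)
    qed
  qed
  have uniq: "a = b" if "((\<lambda>i. f i) \<longlongrightarrow> a) G" "(f \<longlongrightarrow> b) G" for f and a b :: complex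
    using tendsto_unique[OF G that] .
  have g_addl: "g (x + x', y) = g (x, y) + g (x', y)" for x x' y
    by (rule uniq[OF lim]) (unfold addl, intro tendsto_intros lim)
  have g_addr: "g (x, y + y') = g (x, y) + g (x, y')" for x y y'
    by (rule uniq[OF lim]) (unfold addr, intro tendsto_intros lim)
  have g_scalel: "g (c *\<^sub>C x, y) = cnj c * g (x, y)" for c x y
    by (rule uniq[OF lim]) (unfold scalel, intro tendsto_intros lim)
  have g_scaler: "g (x, c *\<^sub>C y) = c * g (x, y)" for c x y
    by (rule uniq[OF lim]) (unfold scaler, intro tendsto_intros lim)
  have g_bdd: "cmod (g (x, y)) \<le> C * norm x * norm y" for x y
    using gB by (auto simp: B_def PiE_def Pi_def dest: spec[of _ x])
  \<comment> \<open>The form is conjugate-linear in \<open>x\<close>, so the Riesz representation is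
    applied to its conjugate.\<close>
  have "\<exists>w. \<forall>x. g (x, y) = cinner x w" for y
  proof -
    obtain w where "\<And>x. cnj (g (x, y)) = cinner w x"
      by (rule riesz_representation[of "\<lambda>x. cnj (g (x, y))" "C * norm y"])
        (use g_bdd in \<open>simp_all add: g_addl g_scalel mult_ac\<close>)
    then have "g (x, y) = cinner x w" for x
      by (metis cinner_commute complex_cnj_cnj)
    then show ?thesis by blast
  qed
  then obtain R where R: "\<And>x y. g (x, y) = cinner x (R y)" by metis
  have R_add: "R (x + y) = R x + R y" for x y
    by (rule cinner_eqI) (simp add: cinner_add_right R[symmetric] g_addr)
  have R_scale: "R (c *\<^sub>C x) = c *\<^sub>C R x" for c x
    by (rule cinner_eqI) (simp add: cinner_scaleC_right R[symmetric] g_scaler)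
  have R_bdd: "norm (R y) \<le> norm y * C" for y
  proof (cases "R y = 0")
    case True
    \<comment> \<open>Nonnegativity of \<open>norm y * C\<close> is read off from the form bound at
      \<open>(y, y)\<close>.\<close>
    have "0 \<le> cmod (g (y, y))" by simp
    also have "\<dots> \<le> C * norm y * norm y" by (rule g_bdd)
    finally have "0 \<le> (norm y * C) * norm y" by (simp add: mult_ac)
    then show ?thesis using True by (cases "y = 0") (auto simp: zero_le_mult_iff)
  next
    case False
    have "norm (R y) * norm (R y) = cmod (g (R y, y))"
      by (simp add: R cinner_self power2_eq_square norm_mult)
    also have "\<dots> \<le> C * norm (R y) * norm y" by (rule g_bdd)
    finally show ?thesis using False by (simp add: mult_ac)
  qed
  have bl: "bounded_linear R"
    by (rule bounded_linear_intro[of _ C]) (simp_all add: R_add scaleR_scaleC R_scale R_bdd)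
  have app: "blinfun_apply (Blinfun R) = R" using bl by (rule bounded_linear_Blinfun_apply)
  show ?thesis
    by (rule that[of "Blinfun R" G]) (use G GF lim in \<open>auto simp: bounded_ops_def app R_scale R\<close>)
qed

section \<open>Complex subspaces, finite orthonormal systems and complex multiples of
  operators\<close>

lemma closure_complex_subspace:
  assumes "complex_vector.subspace (M :: 'a::complex_inner set)"
  shows "complex_vector.subspace (closure M)"
proof -
  have lin: "bounded_linear ((*\<^sub>C) c :: 'a \<Rightarrow> 'a)" for c
    by (rule bounded_linear_intro[of _ "cmod c"])
      (simp_all add: scaleC_add_right scaleR_scaleC scaleC_scaleC norm_scaleC mult.commute)
  show ?thesis
    unfolding complex_vector.subspace_def
  proof (intro conjI ballI allI)
    show "0 \<in> closure M"
      using assms complex_vector.subspace_0 closure_subset by blast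
  next
    fix x y assume "x \<in> closure M" "y \<in> closure M"
    then obtain f g where fg: "\<And>n. f n \<in> M" "f \<longlonglongrightarrow> x" "\<And>n. g n \<in> M" "g \<longlonglongrightarrow> y"
      unfolding closure_sequential by blast
    have "(\<lambda>n. f n + g n) \<longlonglongrightarrow> x + y" using fg by (intro tendsto_add)
    moreover have "\<And>n. f n + g n \<in> M" using fg assms complex_vector.subspace_add by blast
    ultimately show "x + y \<in> closure M" unfolding closure_sequential by metis
  next
    fix c x assume "x \<in> closure M"
    then obtain f where f: "\<And>n. f n \<in> M" "f \<longlonglongrightarrow> x"
      unfolding closure_sequential by blast
    have "(\<lambda>n. c *\<^sub>C f n) \<longlonglongrightarrow> c *\<^sub>C x" using f by (intro bounded_linear.tendsto[OF lin])
    moreover have "\<And>n. c *\<^sub>C f n \<in> M" using f assms complex_vector.subspace_scale by blast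
    ultimately show "c *\<^sub>C x \<in> closure M" unfolding closure_sequential by metis
  qed
qed

definition orthonormal :: "nat \<Rightarrow> (nat \<Rightarrow> 'a::complex_inner) \<Rightarrow> bool"
  where "orthonormal n e \<longleftrightarrow> (\<forall>i<n. \<forall>j<n. cinner (e i) (e j) = (if i = j then 1 else 0))"

text \<open>Each step normalizes the part of the new vector orthogonal to the system so far, if that
  part is nonzero. The expansion formula records that \<open>X\<close> lies in the span.\<close>

lemma gram_schmidt:
  assumes "finite (X :: 'a::complex_inner set)"
  shows "\<exists>n e. orthonormal n e \<and> (\<forall>v\<in>X. v = (\<Sum>i<n. cinner (e i) v *\<^sub>C e i))"
  using assms
proof (induction X rule: finite_induct)
  case empty
  show ?case by (rule exI[of _ 0]) (simp add: orthonormal_def)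
next
  case (insert u X)
  then obtain n e where o: "orthonormal n e"
    and X: "\<And>v. v \<in> X \<Longrightarrow> v = (\<Sum>i<n. cinner (e i) v *\<^sub>C e i)" by blast
  define w where "w = u - (\<Sum>i<n. cinner (e i) u *\<^sub>C e i)"
  have ow: "cinner (e j) w = 0" if j: "j < n" for j
  proof -
    have "cinner (e j) (\<Sum>i<n. cinner (e i) u *\<^sub>C e i) = (\<Sum>i<n. if i = j then cinner (e j) u else 0)"
      unfolding cinner.sum_right using o j
      by (intro sum.cong) (auto simp: orthonormal_def cinner_scaleC_right)
    then show ?thesis using j by (simp add: w_def cinner.diff_right)
  qed
  show ?case
  proof (cases "w = 0")
    case True
    then have "u = (\<Sum>i<n. cinner (e i) u *\<^sub>C e i)" by (simp add: w_def)
    then show ?thesis using o X by (intro exI[of _ n] exI[of _ e]) simp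
  next
    case False
    define k where "k = complex_of_real (1 / norm w)"
    define e' where "e' = e(n := k *\<^sub>C w)"
    have ow': "cinner w (e j) = 0" if "j < n" for j
      using ow[OF that] by (metis cinner_commute complex_cnj_zero)
    have kk: "k * (k * complex_of_real ((norm w)\<^sup>2)) = 1" "cnj k = k"
      using False by (simp_all add: k_def power2_eq_square)
    have o': "orthonormal (Suc n) e'"
      using o kk
      by (auto simp: orthonormal_def e'_def less_Suc_eq cinner_scaleC_left cinner_scaleC_right
          ow ow' cinner_self)
    have sum_e': "(\<Sum>i<Suc n. cinner (e' i) v *\<^sub>C e' i)
        = (\<Sum>i<n. cinner (e i) v *\<^sub>C e i) + (k * k * cinner w v) *\<^sub>C w" for v
      by (simp add: e'_def cinner_scaleC_left kk scaleC_scaleC mult_ac)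
    have "v = (\<Sum>i<Suc n. cinner (e' i) v *\<^sub>C e' i)" if "v \<in> X" for v
    proof -
      have "cinner w v = (\<Sum>i<n. cinner w (cinner (e i) v *\<^sub>C e i))"
        using X[OF that] by (metis cinner.sum_right)
      then have "cinner w v = 0" by (simp add: cinner_scaleC_right ow')
      then show ?thesis unfolding sum_e' using X[OF that] by simp
    qed
    moreover have "u = (\<Sum>i<Suc n. cinner (e' i) u *\<^sub>C e' i)"
    proof -
      have u: "u = w + (\<Sum>i<n. cinner (e i) u *\<^sub>C e i)" by (simp add: w_def)
      have "cinner w u = cinner w w + (\<Sum>i<n. cinner w (cinner (e i) u *\<^sub>C e i))"
        by (metis u cinner_add_right cinner.sum_right)
      then have "cinner w u = complex_of_real ((norm w)\<^sup>2)"
        by (simp add: cinner_scaleC_right ow' cinner_self)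
      then have "k * k * cinner w u = 1" using kk by (simp add: mult_ac)
      then show ?thesis unfolding sum_e' by (simp add: w_def scaleC_one)
    qed
    ultimately show ?thesis using o' by (intro exI[of _ "Suc n"] exI[of _ e']) auto
  qed
qed

lemma bounded_opsD: "R \<in> bounded_ops \<Longrightarrow> blinfun_apply R (c *\<^sub>C x) = c *\<^sub>C blinfun_apply R x"
  by (simp add: bounded_ops_def)

text \<open>Complex multiples of operators are what makes the orbits of
  \<open>\<complex>I \<otimes> \<B>(\<H>)\<close> complex subspaces.\<close>

lemma scaleC_bounded_ops:
  shows "blinfun_apply (Blinfun (\<lambda>x. c *\<^sub>C blinfun_apply B x)) x = c *\<^sub>C blinfun_apply B x"
    and "B \<in> bounded_ops \<Longrightarrow> Blinfun (\<lambda>x. c *\<^sub>C blinfun_apply B x) \<in> bounded_ops"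
proof -
  have comm: "c *\<^sub>C r *\<^sub>R y = r *\<^sub>R c *\<^sub>C y" for r and y :: 'a
    by (simp add: scaleR_scaleC scaleC_scaleC mult.commute)
  have "bounded_linear (\<lambda>x. c *\<^sub>C blinfun_apply B x)"
  proof (rule bounded_linear_intro[of _ "cmod c * norm B"])
    fix x show "norm (c *\<^sub>C blinfun_apply B x) \<le> norm x * (cmod c * norm B)"
      using mult_left_mono[OF norm_blinfun[of B x], of "cmod c"]
      by (simp add: norm_scaleC mult_ac)
  qed (simp_all add: blinfun.add_right blinfun.scaleR_right scaleC_add_right comm)
  note app = bounded_linear_Blinfun_apply[OF this]
  show "blinfun_apply (Blinfun (\<lambda>x. c *\<^sub>C blinfun_apply B x)) x = c *\<^sub>C blinfun_apply B x"
    by (simp add: app)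
  show "Blinfun (\<lambda>x. c *\<^sub>C blinfun_apply B x) \<in> bounded_ops" if "B \<in> bounded_ops"
    using that by (auto simp: bounded_ops_def app scaleC_scaleC mult.commute)
qed

section \<open>Slices of tensors and amplified forms\<close>

locale tensor_product =
  fixes t :: "'l::chilbert_space \<Rightarrow> 'h::chilbert_space \<Rightarrow> 'k::chilbert_space"
  assumes hilbert_tensor: "hilbert_tensor t"
begin

lemma cinner_t: "cinner (t x y) (t x' y') = cinner x x' * cinner y y'"
  using hilbert_tensor by (simp add: hilbert_tensor_def)

lemma t_scaleC: "t (c *\<^sub>C x) y = c *\<^sub>C t x y" "t x (c *\<^sub>C y) = c *\<^sub>C t x y"
  using hilbert_tensor by (simp_all add: hilbert_tensor_def)

lemma norm_t: "norm (t x y) = norm x * norm y"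
proof -
  have "complex_of_real ((norm (t x y))\<^sup>2) = complex_of_real ((norm x * norm y)\<^sup>2)"
    by (simp only: cinner_self[symmetric] cinner_t power_mult_distrib of_real_mult)
  then have "(norm (t x y))\<^sup>2 = (norm x * norm y)\<^sup>2" using of_real_eq_iff by blast
  then show ?thesis by (simp add: power2_eq_iff_nonneg)
qed

sublocale t: bounded_bilinear t
proof
  show "\<exists>K. \<forall>a b. norm (t a b) \<le> norm a * norm b * K"
    by (rule exI[of _ 1]) (simp add: norm_t)
qed (use hilbert_tensor in \<open>simp_all add: hilbert_tensor_def scaleR_scaleC\<close>)

abbreviation algebraic_tensors :: "'k set"
  where "algebraic_tensors \<equiv> cspan {t x y |x y. True}"

lemma closure_algebraic_tensors: "closure algebraic_tensors = UNIV"
  using hilbert_tensor by (simp add: hilbert_tensor_def)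

lemma dense_induct:
  assumes "closed {x. P x}" and "\<And>x. x \<in> algebraic_tensors \<Longrightarrow> P x"
  shows "P x"
  using closure_minimal[of algebraic_tensors "{x. P x}"] assms closure_algebraic_tensors by blast

lemma cinner_tensor_eqI:
  assumes "\<And>v h. cinner (t v h) x = cinner (t v h) y"
  shows "x = y"
proof (rule cinner_eqI)
  fix z
  show "cinner z x = cinner z y"
  proof (rule dense_induct[of "\<lambda>z. cinner z x = cinner z y"])
    show "closed {z. cinner z x = cinner z y}"
      by (intro closed_Collect_eq cinner.continuous_on continuous_intros)
    fix z assume "z \<in> algebraic_tensors"
    then show "cinner z x = cinner z y"
    proof (induction rule: complex_vector.span_induct)
      show "complex_vector.subspace {z. cinner z x = cinner z y}"
        by (auto simp: complex_vector.subspace_def cinner.zero_left cinner_add_left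
            cinner_scaleC_left)
    qed (use assms in blast)
  qed
qed

lemma bounded_ops_eqI:
  assumes R: "R \<in> bounded_ops" "R' \<in> bounded_ops"
    and eq: "\<And>v h. blinfun_apply R (t v h) = blinfun_apply R' (t v h)"
  shows "R = R'"
proof (rule blinfun_eqI)
  fix x
  show "blinfun_apply R x = blinfun_apply R' x"
  proof (rule dense_induct[of "\<lambda>z. blinfun_apply R z = blinfun_apply R' z"])
    show "closed {z. blinfun_apply R z = blinfun_apply R' z}"
      by (intro closed_Collect_eq blinfun.continuous_on continuous_intros)
    fix z assume "z \<in> algebraic_tensors"
    then show "blinfun_apply R z = blinfun_apply R' z"
    proof (induction rule: complex_vector.span_induct)
      show "complex_vector.subspace {z. blinfun_apply R z = blinfun_apply R' z}"
        using R by (auto simp: complex_vector.subspace_def blinfun.add_right bounded_opsD)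
    qed (use eq in blast)
  qed
qed

text \<open>The adjoint of \<open>h \<mapsto> t e h\<close>.\<close>

definition slice :: "'l \<Rightarrow> 'k \<Rightarrow> 'h"
  where "slice e x = (SOME h. \<forall>h'. cinner h' h = cinner (t e h') x)"

text \<open>The \<open>SOME\<close> has a witness: Riesz represents the bounded linear functional
  \<open>h \<mapsto> cinner x (t e h)\<close>.\<close>

lemma cinner_slice: "cinner h (slice e x) = cinner (t e h) x"
proof -
  obtain w where "\<And>h. cinner x (t e h) = cinner w h"
  proof (rule riesz_representation[of "\<lambda>h. cinner x (t e h)" "norm x * norm e"])
    fix h show "cmod (cinner x (t e h)) \<le> norm x * norm e * norm h"
      using cauchy_schwarz[of x "t e h"] by (simp add: norm_t mult_ac)
  qed (simp_all add: t.add_right t_scaleC cinner_add_right cinner_scaleC_right)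
  then have "\<exists>w. \<forall>h. cinner h w = cinner (t e h) x"
    by (metis cinner_commute)
  from someI_ex[OF this] show ?thesis by (simp add: slice_def)
qed

lemma slice_add: "slice e (x + y) = slice e x + slice e y"
  by (rule cinner_eqI) (simp add: cinner_slice cinner_add_right)

lemma slice_scaleC: "slice e (c *\<^sub>C x) = c *\<^sub>C slice e x"
  by (rule cinner_eqI) (simp add: cinner_slice cinner_scaleC_right)

lemma slice_t: "slice e (t v h) = cinner e v *\<^sub>C h"
  by (rule cinner_eqI) (simp add: cinner_slice cinner_scaleC_right cinner_t)

text \<open>For orthonormal \<open>e\<close> this is the isometric embedding of \<open>n\<close>
  copies of \<open>'h\<close> with range span(e) \<otimes> \<open>'h\<close>. Applied to the slices
  of \<open>x\<close>, it gives the orthogonal projection of \<open>x\<close> onto that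
  range.\<close>

definition assemble :: "nat \<Rightarrow> (nat \<Rightarrow> 'l) \<Rightarrow> (nat \<Rightarrow> 'h) \<Rightarrow> 'k"
  where "assemble n e f = (\<Sum>i<n. t (e i) (f i))"

lemma cinner_assemble:
  assumes "orthonormal n e"
  shows "cinner (assemble n e f) (assemble n e g) = (\<Sum>i<n. cinner (f i) (g i))"
proof -
  have "cinner (assemble n e f) (assemble n e g)
      = (\<Sum>i<n. \<Sum>j<n. if i = j then cinner (f i) (g i) else 0)"
    unfolding assemble_def cinner.sum_left cinner.sum_right using assms
    by (intro sum.cong refl) (auto simp: cinner_t orthonormal_def)
  also have "\<dots> = (\<Sum>i<n. cinner (f i) (g i))"
    by simp
  finally show ?thesis .
qed

lemma norm_assemble:
  assumes "orthonormal n e"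
  shows "(norm (assemble n e f))\<^sup>2 = (\<Sum>i<n. (norm (f i))\<^sup>2)"
proof -
  have "complex_of_real ((norm (assemble n e f))\<^sup>2) = complex_of_real (\<Sum>i<n. (norm (f i))\<^sup>2)"
    by (simp only: cinner_self[symmetric] cinner_assemble[OF assms] of_real_sum)
  then show ?thesis using of_real_eq_iff by blast
qed

text \<open>The vector \<open>s\<close> assembled from the slices satisfies
  \<open>cinner s x = cinner s s\<close>, so the squared norm of \<open>x - s\<close> is the
  difference of the squared norms of \<open>x\<close> and \<open>s\<close>.\<close>

lemma slice_bessel:
  assumes "orthonormal n e"
  shows "(\<Sum>i<n. (norm (slice (e i) x))\<^sup>2) \<le> (norm x)\<^sup>2"
proof -
  define s where "s = assemble n e (\<lambda>i. slice (e i) x)"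
  have s: "(norm s)\<^sup>2 = (\<Sum>i<n. (norm (slice (e i) x))\<^sup>2)"
    unfolding s_def by (rule norm_assemble[OF assms])
  have "cinner s x = (\<Sum>i<n. cinner (slice (e i) x) (slice (e i) x))"
    by (simp add: s_def assemble_def cinner.sum_left cinner_slice)
  then have "Re (cinner s x) = (norm s)\<^sup>2"
    by (simp add: s cinner_self flip: of_real_power)
  then have "Re (cinner x s) = (norm s)\<^sup>2"
    by (metis cinner_commute cnj.simps(1))
  then have "(norm (x + - s))\<^sup>2 = (norm x)\<^sup>2 - (norm s)\<^sup>2"
    unfolding norm_add_square by (simp add: cinner.minus_right)
  then have "0 \<le> (norm x)\<^sup>2 - (norm s)\<^sup>2" by (metis zero_le_power2)
  then show ?thesis using s by simp
qed

text \<open>An algebraic tensor involves finitely many vectors of the first factor. As soon as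
  \<open>X\<close> contains them, the projection onto the span of \<open>e X\<close> tensored with
  the second factor fixes it.\<close>

lemma eventually_assemble_slices:
  assumes span: "\<And>X v. finite X \<Longrightarrow> v \<in> X \<Longrightarrow> v = (\<Sum>i<n X. cinner (e X i) v *\<^sub>C e X i)"
    and x: "x \<in> algebraic_tensors"
  shows "\<forall>\<^sub>F X in finite_subsets_at_top UNIV. x = assemble (n X) (e X) (\<lambda>i. slice (e X i) x)"
  using x
proof (induction rule: complex_vector.span_induct)
  show "complex_vector.subspace {x. \<forall>\<^sub>F X in finite_subsets_at_top UNIV.
      x = assemble (n X) (e X) (\<lambda>i. slice (e X i) x)}" (is "complex_vector.subspace {x. ?P x}")
    unfolding complex_vector.subspace_def
  proof (intro conjI ballI allI; simp only: mem_Collect_eq)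
    have "slice e 0 = 0" for e using slice_scaleC[of e 0 0] by simp
    then show "?P 0" by (simp add: assemble_def t.zero_right)
  next
    fix x y assume "?P x" "?P y"
    then show "?P (x + y)"
    proof eventually_elim
      case (elim X)
      have "x + y = assemble (n X) (e X) (\<lambda>i. slice (e X i) x)
          + assemble (n X) (e X) (\<lambda>i. slice (e X i) y)"
        using elim by simp
      also have "\<dots> = assemble (n X) (e X) (\<lambda>i. slice (e X i) (x + y))"
        by (simp add: assemble_def slice_add t.add_right sum.distrib)
      finally show ?case .
    qed
  next
    fix c x assume "?P x"
    then show "?P (c *\<^sub>C x)"
    proof eventually_elim
      case (elim X)
      have "c *\<^sub>C x = c *\<^sub>C assemble (n X) (e X) (\<lambda>i. slice (e X i) x)"
        using elim by simp
      also have "\<dots> = assemble (n X) (e X) (\<lambda>i. slice (e X i) (c *\<^sub>C x))"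
        by (simp add: assemble_def slice_scaleC t_scaleC complex_vector.scale_sum_right)
      finally show ?case .
    qed
  qed
next
  fix x assume "x \<in> {t x y |x y. True}"
  then obtain v h where x: "x = t v h" by blast
  show "\<forall>\<^sub>F X in finite_subsets_at_top UNIV. x = assemble (n X) (e X) (\<lambda>i. slice (e X i) x)"
    unfolding eventually_finite_subsets_at_top
  proof (intro exI[of _ "{v}"] conjI allI impI)
    fix X assume X: "finite X \<and> {v} \<subseteq> X \<and> X \<subseteq> UNIV"
    then have v: "v = (\<Sum>i<n X. cinner (e X i) v *\<^sub>C e X i)" by (intro span) auto
    have "t v h = t (\<Sum>i<n X. cinner (e X i) v *\<^sub>C e X i) h"
      using v by simp
    also have "\<dots> = assemble (n X) (e X) (\<lambda>i. slice (e X i) (t v h))"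
      by (simp add: assemble_def slice_t t.sum_left t_scaleC)
    finally show "x = assemble (n X) (e X) (\<lambda>i. slice (e X i) x)"
      unfolding x .
  qed auto
qed

text \<open>For fixed \<open>a\<close>, the sum in the conclusion is the form of \<open>Q \<otimes> a\<close> with \<open>Q\<close> the projection onto
  the span of \<open>e X 0, \<dots>, e X (n X - 1)\<close>; these spans exhaust \<open>'l\<close>, so that weak cluster points lie
  in \<open>\<complex>I \<otimes> \<B>(\<H>)\<close>.\<close>

lemma amplified_forms_cluster:
  fixes n :: "'l set \<Rightarrow> nat" and e :: "'l set \<Rightarrow> nat \<Rightarrow> 'l"
    and a :: "'l set \<Rightarrow> 'h \<Rightarrow> 'h \<Rightarrow> complex"
  assumes orth: "\<And>X. orthonormal (n X) (e X)"
    and span: "\<And>X v. finite X \<Longrightarrow> v \<in> X \<Longrightarrow> v = (\<Sum>i<n X. cinner (e X i) v *\<^sub>C e X i)"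
    and addl: "\<And>X x x' y. a X (x + x') y = a X x y + a X x' y"
    and addr: "\<And>X x y y'. a X x (y + y') = a X x y + a X x y'"
    and scalel: "\<And>X c x y. a X (c *\<^sub>C x) y = cnj c * a X x y"
    and scaler: "\<And>X c x y. a X x (c *\<^sub>C y) = c * a X x y"
    and bdd: "\<And>X x y. cmod (a X x y) \<le> C * norm x * norm y" and C: "0 \<le> C"
  obtains R G A where "R \<in> bounded_ops" and "G \<noteq> bot" and "G \<le> finite_subsets_at_top UNIV"
    and "\<And>x y. ((\<lambda>X. \<Sum>i<n X. a X (slice (e X i) x) (slice (e X i) y))
           \<longlongrightarrow> cinner x (blinfun_apply R y)) G"
    and "A \<in> bounded_ops" and "\<And>v h. blinfun_apply R (t v h) = t v (blinfun_apply A h)"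
    and "\<And>(v::'l) v' h h'. ((\<lambda>X. cinner v' v * a X h' h) \<longlongrightarrow> cinner v' v * cinner h' (blinfun_apply A h)) G"
proof -
  define r where "r X x y = (\<Sum>i<n X. a X (slice (e X i) x) (slice (e X i) y))" for X x y
  have r_bdd: "cmod (r X x y) \<le> C * norm x * norm y" for X x y
  proof -
    \<comment> \<open>Cauchy-Schwarz for the sum and Bessel for the slices give a bound uniform in
      \<open>X\<close>, however many summands there are.\<close>
    have L2: "L2_set (\<lambda>i. norm (slice (e X i) x)) {..<n X} \<le> norm x" for x
      unfolding L2_set_def using slice_bessel[OF orth, of X x] by (simp add: real_le_lsqrt)
    have "cmod (r X x y) \<le> (\<Sum>i<n X. cmod (a X (slice (e X i) x) (slice (e X i) y)))"
      unfolding r_def by (rule norm_sum)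
    also have "\<dots> \<le> (\<Sum>i<n X. C * norm (slice (e X i) x) * norm (slice (e X i) y))"
      by (intro sum_mono bdd)
    also have "\<dots> = C * (\<Sum>i<n X. \<bar>norm (slice (e X i) x)\<bar> * \<bar>norm (slice (e X i) y)\<bar>)"
      by (simp add: sum_distrib_left mult_ac)
    also have "\<dots> \<le> C * (norm x * norm y)"
      by (intro mult_left_mono C order_trans[OF L2_set_mult_ineq] mult_mono L2) auto
    finally show ?thesis by (simp add: mult_ac)
  qed
  obtain R G where R: "R \<in> bounded_ops" and G: "G \<noteq> bot" "G \<le> finite_subsets_at_top UNIV"
    and lim: "\<And>x y. ((\<lambda>X. r X x y) \<longlongrightarrow> cinner x (blinfun_apply R y)) G"
  proof (rule bounded_forms_cluster_operator[of "finite_subsets_at_top UNIV" r C])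
  qed (use r_bdd in \<open>simp_all add: r_def slice_add slice_scaleC addl addr scalel scaler
      sum.distrib sum_distrib_left\<close>)
  \<comment> \<open>Once \<open>X\<close> contains \<open>v'\<close>, expanding \<open>v'\<close> in
    the system \<open>e X\<close> collapses the sum on elementary tensors.\<close>
  have lim_t: "((\<lambda>X. cinner v' v * a X h' h) \<longlongrightarrow> cinner (t v' h') (blinfun_apply R (t v h))) G" for v v' h h'
  proof (rule Lim_transform_eventually[OF lim])
    have "\<forall>\<^sub>F X in finite_subsets_at_top UNIV. r X (t v' h') (t v h) = cinner v' v * a X h' h"
      unfolding eventually_finite_subsets_at_top
    proof (intro exI[of _ "{v'}"] conjI allI impI)
      fix X assume "finite X \<and> {v'} \<subseteq> X \<and> X \<subseteq> UNIV"
      then have "v' = (\<Sum>i<n X. cinner (e X i) v' *\<^sub>C e X i)" by (intro span) auto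
      then have "cinner v' v = (\<Sum>i<n X. cinner (cinner (e X i) v' *\<^sub>C e X i) v)"
        by (metis cinner.sum_left)
      then show "r X (t v' h') (t v h) = cinner v' v * a X h' h"
        by (simp add: r_def slice_t scalel scaler cinner_scaleC_left sum_distrib_left
            mult_ac)
    qed auto
    then show "\<forall>\<^sub>F X in G. r X (t v' h') (t v h) = cinner v' v * a X h' h"
      using G(2) filter_leD by blast
  qed
  \<comment> \<open>\<open>A\<close> is the compression of \<open>R\<close> along
    \<open>h \<mapsto> t u h\<close> for one nonzero \<open>u\<close>, divided by the square of the
    norm of \<open>u\<close>. Over a zero first factor all elementary tensors vanish and
    \<open>0\<close> serves.\<close>
  obtain A where A: "A \<in> bounded_ops" "\<And>v h. blinfun_apply R (t v h) = t v (blinfun_apply A h)"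
  proof (cases "\<exists>e::'l. e \<noteq> 0")
    case False
    then have "v = 0" for v :: 'l by blast
    then have "t v h = 0" for v h using t.zero_left by metis
    then have "blinfun_apply R (t v h) = t v (blinfun_apply 0 h)" for v h
      by simp
    then show ?thesis using that[of 0] by (simp add: bounded_ops_def)
  next
    case True
    then obtain u :: 'l where u: "u \<noteq> 0" by blast
    define k where "k = complex_of_real (1 / (norm u)\<^sup>2)"
    have ku: "k * cinner u u = 1" using u by (simp add: k_def cinner_self)
    define A0 where "A0 h = k *\<^sub>C slice u (blinfun_apply R (t u h))" for h
    have cA0: "cinner h' (A0 h) = k * cinner (t u h') (blinfun_apply R (t u h))" for h h'
      by (simp add: A0_def cinner_scaleC_right cinner_slice)
    have A0_add: "A0 (x + y) = A0 x + A0 y" for x y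
      by (rule cinner_eqI) (simp add: cA0 t.add_right blinfun.add_right cinner_add_right distrib_left)
    have A0_scale: "A0 (c *\<^sub>C x) = c *\<^sub>C A0 x" for c x
      by (rule cinner_eqI) (simp add: cA0 t_scaleC bounded_opsD[OF R] cinner_scaleC_right)
    define D where "D = cmod k * norm u * norm R * norm u"
    have A0_bdd: "norm (A0 x) \<le> norm x * D" for x
    proof (cases "A0 x = 0")
      case False
      have "norm (A0 x) * norm (A0 x) = cmod (cinner (A0 x) (A0 x))"
        by (simp add: cinner_self norm_mult power2_eq_square)
      also have "\<dots> \<le> cmod k * (norm (t u (A0 x)) * norm (blinfun_apply R (t u x)))"
        unfolding cA0 norm_mult by (intro mult_left_mono cauchy_schwarz) simp
      also have "\<dots> \<le> cmod k * (norm (t u (A0 x)) * (norm R * norm (t u x)))"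
        by (intro mult_left_mono norm_blinfun) simp_all
      also have "\<dots> = norm x * D * norm (A0 x)" by (simp add: norm_t D_def mult_ac)
      finally show ?thesis using False by simp
    qed (simp add: D_def)
    have bl: "bounded_linear A0"
      by (rule bounded_linear_intro[of _ D]) (simp_all add: A0_add scaleR_scaleC A0_scale A0_bdd)
    have app: "blinfun_apply (Blinfun A0) = A0" using bl by (rule bounded_linear_Blinfun_apply)
    \<comment> \<open>Two limits along \<open>G\<close> are compared: the case
      \<open>v = v' = u\<close> of \<open>lim_t\<close> makes \<open>a X h' h\<close> itself
      converge to the form of \<open>A0\<close>.\<close>
    have "cinner (t v' h') (blinfun_apply R (t v h)) = cinner (t v' h') (t v (A0 h))" for v v' h h'
    proof (rule tendsto_unique[OF G(1) lim_t])
      have "((\<lambda>X. cinner v' v * (k * (cinner u u * a X h' h)))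
          \<longlongrightarrow> cinner v' v * (k * cinner (t u h') (blinfun_apply R (t u h)))) G"
        by (intro tendsto_intros lim_t)
      moreover have "k * (cinner u u * z) = z" for z
        using ku by (simp add: mult.assoc[symmetric])
      ultimately show "((\<lambda>X. cinner v' v * a X h' h) \<longlongrightarrow> cinner (t v' h') (t v (A0 h))) G"
        by (simp add: cinner_t cA0)
    qed
    then have "blinfun_apply R (t v h) = t v (A0 h)" for v h
      by (intro cinner_tensor_eqI)
    then show ?thesis using that[of "Blinfun A0"] by (simp add: bounded_ops_def app A0_scale)
  qed
  \<comment> \<open>The factor \<open>cinner v' v\<close> covers the zero first factor, where
    \<open>A\<close> is \<open>0\<close> whatever the forms \<open>a X\<close> are.\<close>
  have "((\<lambda>X. cinner v' v * a X h' h) \<longlongrightarrow> cinner v' v * cinner h' (blinfun_apply A h)) G"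
    for v v' :: 'l and h h'
    using lim_t[of v' v h' h] by (simp add: A(2) cinner_t)
  then show ?thesis
    by (rule that[OF R G lim[unfolded r_def] A])
qed

text \<open>The finite subsets of the first factor, directed by inclusion, index finite-dimensional
  subspaces that exhaust it, whatever its dimension.\<close>

lemma exhausting_orthonormal_systems:
  obtains n :: "'l set \<Rightarrow> nat" and e :: "'l set \<Rightarrow> nat \<Rightarrow> 'l"
  where "\<And>X. orthonormal (n X) (e X)"
    and "\<And>X v. finite X \<Longrightarrow> v \<in> X \<Longrightarrow> v = (\<Sum>i<n X. cinner (e X i) v *\<^sub>C e X i)"
proof -
  have "\<exists>n e. orthonormal n e \<and> (finite X \<longrightarrow> (\<forall>v\<in>X. v = (\<Sum>i<n. cinner (e i) v *\<^sub>C e i)))"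
    for X :: "'l set"
  proof (cases "finite X")
    \<comment> \<open>Infinite index sets get the empty system, so that orthonormality holds for
      every \<open>X\<close>.\<close>
    case False
    then show ?thesis by (intro exI[of _ 0]) (simp add: orthonormal_def)
  qed (use gram_schmidt in blast)
  then obtain n e where "orthonormal (n X) (e X) \<and>
      (finite X \<longrightarrow> (\<forall>v\<in>X. v = (\<Sum>i<n X. cinner (e X i) v *\<^sub>C e X i)))" for X :: "'l set"
    by metis
  then show ?thesis using that by blast
qed

section \<open>The algebra \<open>\<complex>I \<otimes> \<B>(\<H>)\<close>\<close>

lemma tensor_op_eqI:
  assumes "R \<in> bounded_ops" and "\<And>v h. blinfun_apply R (t v h) = t v (blinfun_apply A h)"
  shows "tensor_op t id_blinfun A = R"
  unfolding tensor_op_def using assms by (intro the_equality bounded_ops_eqI) auto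

text \<open>Existence of \<open>I \<otimes> A\<close> comes from
  \<open>amplified_forms_cluster\<close> with the form of \<open>A\<close> at every index: the
  finite-dimensional projections tensored with \<open>A\<close> cluster at
  \<open>I \<otimes> A\<close>.\<close>

lemma tensor_op_id:
  assumes A: "A \<in> bounded_ops"
  shows "tensor_op t id_blinfun A \<in> bounded_ops"
    and "blinfun_apply (tensor_op t id_blinfun A) (t v h) = t v (blinfun_apply A h)"
proof -
  obtain n e where orth: "\<And>X::'l set. orthonormal (n X) (e X)"
    and span: "\<And>X v. finite X \<Longrightarrow> v \<in> X \<Longrightarrow> v = (\<Sum>i<n X. cinner (e X i) v *\<^sub>C e X i)"
    by (rule exhausting_orthonormal_systems, rule that)
  have bdd: "cmod (cinner h' (blinfun_apply A h)) \<le> norm A * norm h' * norm h" for h h'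
    using order_trans[OF cauchy_schwarz mult_left_mono[OF norm_blinfun norm_ge_zero], of h' A h]
    by (simp add: mult_ac)
  obtain R G A' where R: "R \<in> bounded_ops" and G: "G \<noteq> bot"
    and RA: "\<And>v h. blinfun_apply R (t v h) = t v (blinfun_apply A' h)"
    and lim: "\<And>(v::'l) v' h h'. ((\<lambda>X::'l set. cinner v' v * cinner h' (blinfun_apply A h))
        \<longlongrightarrow> cinner v' v * cinner h' (blinfun_apply A' h)) G"
  proof (rule amplified_forms_cluster[of n e "\<lambda>_ h' h. cinner h' (blinfun_apply A h)" "norm A"])
  qed (use orth span bdd A in \<open>auto simp: cinner_add_left cinner_add_right cinner_scaleC_left
      cinner_scaleC_right blinfun.add_right bounded_opsD\<close>)
  \<comment> \<open>The comparison is made after tensoring, since over a zero first factor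
    \<open>A'\<close> may differ from \<open>A\<close>.\<close>
  have "blinfun_apply R (t v h) = t v (blinfun_apply A h)" for v h
  proof (rule cinner_tensor_eqI)
    fix v' h'
    show "cinner (t v' h') (blinfun_apply R (t v h)) = cinner (t v' h') (t v (blinfun_apply A h))"
      using tendsto_unique[OF G lim[of v' v h' h] tendsto_const] by (simp add: RA cinner_t)
  qed
  then show "tensor_op t id_blinfun A \<in> bounded_ops"
    "blinfun_apply (tensor_op t id_blinfun A) (t v h) = t v (blinfun_apply A h)"
    using tensor_op_eqI[OF R] R by auto
qed

text \<open>Ensures that \<open>orth_proj\<close> onto the orbit closure is a genuine
  projection.\<close>

lemma subspace_orbit: "complex_vector.subspace ((\<lambda>A. blinfun_apply A x) ` scalar_tensor_ops t)"
proof -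
  let ?I = "\<lambda>A. tensor_op t id_blinfun A"
  have mem: "blinfun_apply R x \<in> (\<lambda>A. blinfun_apply A x) ` scalar_tensor_ops t"
    if "R \<in> bounded_ops" "A \<in> bounded_ops" "\<And>v h. blinfun_apply R (t v h) = t v (blinfun_apply A h)" for R A
    using tensor_op_eqI[of R A] that by (force simp: scalar_tensor_ops_def)
  show ?thesis
    unfolding complex_vector.subspace_def
  proof (intro conjI ballI allI)
    show "0 \<in> (\<lambda>A. blinfun_apply A x) ` scalar_tensor_ops t"
      using mem[of 0 0] by (simp add: bounded_ops_def t.zero_right)
  next
    fix y z assume "y \<in> (\<lambda>A. blinfun_apply A x) ` scalar_tensor_ops t"
      "z \<in> (\<lambda>A. blinfun_apply A x) ` scalar_tensor_ops t"
    then obtain A B where AB: "A \<in> bounded_ops" "B \<in> bounded_ops"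
      "y = blinfun_apply (?I A) x" "z = blinfun_apply (?I B) x"
      by (auto simp: scalar_tensor_ops_def)
    have "blinfun_apply (?I A + ?I B) x \<in> (\<lambda>A. blinfun_apply A x) ` scalar_tensor_ops t"
      by (rule mem[of _ "A + B"])
        (use AB tensor_op_id[of A] tensor_op_id[of B] in
          \<open>auto simp: bounded_ops_def blinfun.add_left scaleC_add_right t.add_right\<close>)
    then show "y + z \<in> (\<lambda>A. blinfun_apply A x) ` scalar_tensor_ops t"
      by (simp add: AB blinfun.add_left)
  next
    fix c y assume "y \<in> (\<lambda>A. blinfun_apply A x) ` scalar_tensor_ops t"
    then obtain A where A: "A \<in> bounded_ops" "y = blinfun_apply (?I A) x"
      by (auto simp: scalar_tensor_ops_def)
    have "blinfun_apply (Blinfun (\<lambda>x. c *\<^sub>C blinfun_apply (?I A) x)) x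
        \<in> (\<lambda>A. blinfun_apply A x) ` scalar_tensor_ops t"
      by (rule mem[of _ "Blinfun (\<lambda>x. c *\<^sub>C blinfun_apply A x)"])
        (use A(1) tensor_op_id[of A] in \<open>auto simp: scaleC_bounded_ops t_scaleC\<close>)
    then show "c *\<^sub>C y \<in> (\<lambda>A. blinfun_apply A x) ` scalar_tensor_ops t"
      by (simp add: A scaleC_bounded_ops)
  qed
qed

text \<open>A \<open>z\<close> orthogonal to the orbit of \<open>x\<close> is orthogonal to its
  closure, so pairing with \<open>z\<close> sees only the part of \<open>T x\<close> that
  \<open>dist_beta\<close> measures, after normalizing \<open>x\<close>. This turns
  \<open>dist_beta\<close> into a bound on forms.\<close>

lemma dist_beta_estimate:
  assumes b: "dist_beta (scalar_tensor_ops t) T = ennreal b" "0 \<le> b"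
    and z: "\<And>A. A \<in> bounded_ops \<Longrightarrow> cinner z (blinfun_apply (tensor_op t id_blinfun A) x) = 0"
  shows "cmod (cinner z (blinfun_apply T x)) \<le> b * norm z * norm x"
proof (cases "x = 0")
  case True
  then show ?thesis by (simp add: cinner.zero_right)
next
  case False
  define y where "y = (1 / norm x) *\<^sub>R x"
  have x: "x = norm x *\<^sub>R y" and y1: "norm y = 1" using False by (simp_all add: y_def)
  define M where "M = orbit_closure (scalar_tensor_ops t) y"
  define p where "p = orth_proj M (blinfun_apply T y)"
  have "p \<in> M"
    unfolding p_def M_def orbit_closure_def
    by (intro orth_proj_in closure_complex_subspace subspace_orbit closed_closure)
  have "ennreal (norm (blinfun_apply T y - p)) \<le> dist_beta (scalar_tensor_ops t) T"
    unfolding dist_beta_def p_def M_def by (rule SUP_upper) (simp add: y1)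
  then have le: "norm (blinfun_apply T y - p) \<le> b" using b by simp
  have "M \<subseteq> {m. cinner z m = 0}"
    unfolding M_def orbit_closure_def
  proof (rule closure_minimal)
    show "closed {m. cinner z m = 0}"
      by (intro closed_Collect_eq cinner.continuous_on continuous_intros)
    show "(\<lambda>A. blinfun_apply A y) ` scalar_tensor_ops t \<subseteq> {m. cinner z m = 0}"
      using z by (auto simp: scalar_tensor_ops_def y_def blinfun.scaleR_right cinner.scaleR_right)
  qed
  then have "cinner z (blinfun_apply T y) = cinner z (blinfun_apply T y - p)"
    using \<open>p \<in> M\<close> by (auto simp: cinner.diff_right)
  also have "cmod \<dots> \<le> norm z * b"
    by (rule order_trans[OF cauchy_schwarz mult_left_mono[OF le]]) simp
  finally have "norm x * cmod (cinner z (blinfun_apply T y)) \<le> norm x * (norm z * b)"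
    by (intro mult_left_mono) auto
  moreover have "cmod (cinner z (blinfun_apply T x)) = norm x * cmod (cinner z (blinfun_apply T y))"
    by (subst x) (simp add: blinfun.scaleR_right cinner.scaleR_right)
  ultimately show ?thesis by (simp add: mult_ac)
qed

end

section \<open>Averaging over symmetries\<close>

text \<open>The involution sending \<open>k\<close> to \<open>a - k\<close> modulo \<open>n\<close>,
  on representatives below \<open>n\<close>.\<close>

definition reflect :: "nat \<Rightarrow> nat \<Rightarrow> nat \<Rightarrow> nat"
  where "reflect n a k = (if k \<le> a then a - k else n + a - k)"

lemma reflect_less: "a < n \<Longrightarrow> k < n \<Longrightarrow> reflect n a k < n"
  by (auto simp: reflect_def)

lemma reflect_reflect: "a < n \<Longrightarrow> k < n \<Longrightarrow> reflect n a (reflect n a k) = k"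
  by (auto simp: reflect_def)

text \<open>With \<open>k\<close> fixed and \<open>a\<close> varying, \<open>a - k\<close> runs
  through all residues; the inverse sends \<open>i\<close> to \<open>i + k\<close> modulo
  \<open>n\<close>.\<close>

lemma sum_reflect:
  assumes "k < n"
  shows "(\<Sum>a<n. F (reflect n a k)) = (\<Sum>i<n. F i)"
  by (rule sum.reindex_bij_witness[of _ "\<lambda>i. if i + k < n then i + k else i + k - n"
        "\<lambda>a. reflect n a k"])
    (use assms in \<open>auto simp: reflect_def\<close>)

text \<open>The term \<open>- real a\<close> makes the matrix with entries \<open>phase n a b k\<close> at \<open>(k, reflect n a k)\<close>
  self-adjoint; it cancels in the products of \<open>sum_phase\<close>.\<close>

definition phase :: "nat \<Rightarrow> nat \<Rightarrow> nat \<Rightarrow> nat \<Rightarrow> complex"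
  where "phase n a b k = cis (pi * real b * (2 * real k - real a) / real n)"

lemma norm_phase: "cmod (phase n a b k) = 1"
  by (simp add: phase_def)

text \<open>The exponents \<open>2k - a\<close> and \<open>2(a - k) - a\<close> cancel; a
  wrap-around by \<open>n\<close> changes the angle by a multiple of a full turn.\<close>

lemma phase_reflect:
  assumes "a < n" "k < n"
  shows "phase n a b k * phase n a b (reflect n a k) = 1"
proof (cases "k \<le> a")
  case True
  then show ?thesis
    by (simp add: phase_def reflect_def cis_mult of_nat_diff flip: add_divide_distrib)
      (simp add: algebra_simps)
next
  case False
  have "pi * real b * (2 * real k - real a) / real n
      + pi * real b * (2 * real (n + a - k) - real a) / real n = 2 * pi * real b"
    using assms by (simp add: field_simps of_nat_diff)
  then show ?thesis
    using False by (simp add: phase_def reflect_def cis_mult cis_multiple_2pi)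
qed

text \<open>Orthogonality of the characters of the cyclic group of order \<open>n\<close>: the
  summands are powers of an \<open>n\<close>-th root of unity, which is \<open>1\<close> only for
  \<open>k = l\<close>.\<close>

lemma sum_phase:
  assumes "k < n" "l < n"
  shows "(\<Sum>b<n. cnj (phase n a b k) * phase n a b l) = (if k = l then of_nat n else 0)"
proof -
  define \<theta> where "\<theta> = 2 * pi * (real l - real k) / real n"
  have "cnj (phase n a b k) * phase n a b l = cis \<theta> ^ b" for b
    unfolding phase_def cis_cnj cis_mult Complex.DeMoivre \<theta>_def
    by (rule arg_cong[of _ _ cis]) (use assms in \<open>simp add: field_simps\<close>)
  then have eq: "(\<Sum>b<n. cnj (phase n a b k) * phase n a b l) = (\<Sum>b<n. cis \<theta> ^ b)" by simp
  show ?thesis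
  proof (cases "k = l")
    case True
    then show ?thesis unfolding eq by (simp add: \<theta>_def)
  next
    case False
    have "cis \<theta> \<noteq> 1"
    proof
      assume "cis \<theta> = 1"
      then have "cos \<theta> = 1" by (metis cis.simps(1) one_complex.simps(1))
      then obtain m :: int where "\<theta> = of_int m * (2 * pi)"
        unfolding cos_one_2pi_int by (auto simp: mult_ac)
      then have "(2 * pi) * ((real l - real k) / real n) = (2 * pi) * of_int m"
        by (simp add: \<theta>_def mult_ac)
      then have "(real l - real k) / real n = of_int m"
        by (simp only: mult_cancel_left) simp
      then have "real l - real k = of_int m * real n"
        using assms by (simp add: field_simps)
      then have m: "int l - int k = m * int n"
        by (metis of_int_diff of_int_eq_iff of_int_mult of_int_of_nat_eq)
      \<comment> \<open>Both indices lie below \<open>n\<close>, so a difference divisible by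
        \<open>n\<close> is zero.\<close>
      then have "\<bar>m\<bar> * int n < 1 * int n" using assms by (simp flip: abs_mult[of m "int n", simplified])
      then have "m = 0" using assms by simp
      then show False using m False by simp
    qed
    moreover have "cis \<theta> ^ n = 1"
    proof -
      have "real n * \<theta> = 2 * pi * of_int (int l - int k)" using assms by (simp add: \<theta>_def)
      then show ?thesis unfolding Complex.DeMoivre by (metis Ints_of_int cis_multiple_2pi)
    qed
    ultimately show ?thesis unfolding eq using False by (simp add: geometric_sum)
  qed
qed

section \<open>Block averages and the distance estimate\<close>

context tensor_product
begin

lemma assemble_add: "assemble n e (\<lambda>i. f i + g i) = assemble n e f + assemble n e g"
  by (simp add: assemble_def t.add_right sum.distrib)

lemma assemble_diff: "assemble n e (\<lambda>i. f i - g i) = assemble n e f - assemble n e g"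
  by (simp add: assemble_def t.diff_right sum_subtractf)

text \<open>Below, \<open>P\<close> and \<open>Q\<close> are twice the spectral projections of the symmetry \<open>U\<close>; their ranges are
  orthogonal and invariant under \<open>\<complex>I \<otimes> \<B>(\<H>)\<close>.\<close>

lemma symmetry_estimate:
  assumes orth: "orthonormal n e" and b: "0 \<le> b"
    and T: "\<And>x z. (\<And>A. A \<in> bounded_ops \<Longrightarrow>
        cinner z (blinfun_apply (tensor_op t id_blinfun A) x) = 0) \<Longrightarrow>
        cmod (cinner z (blinfun_apply T x)) \<le> b * norm z * norm x"
    and \<sigma>: "\<And>k. k < n \<Longrightarrow> \<sigma> k < n" "\<And>k. k < n \<Longrightarrow> \<sigma> (\<sigma> k) = k"
    and \<phi>: "\<And>k. k < n \<Longrightarrow> \<phi> k * \<phi> (\<sigma> k) = 1" "\<And>k. cmod (\<phi> k) = 1"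
  shows "cmod (cinner (assemble n e f) (blinfun_apply T (assemble n e g))
      - cinner (assemble n e (\<lambda>k. \<phi> k *\<^sub>C f (\<sigma> k)))
          (blinfun_apply T (assemble n e (\<lambda>k. \<phi> k *\<^sub>C g (\<sigma> k)))))
    \<le> 2 * b * norm (assemble n e f) * norm (assemble n e g)"
proof -
  define U where "U f = (\<lambda>k. \<phi> k *\<^sub>C f (\<sigma> k))" for f :: "nat \<Rightarrow> 'h"
  define W where "W = assemble n e"
  define P where "P f = (\<lambda>k. f k + U f k)" for f
  define Q where "Q f = (\<lambda>k. f k - U f k)" for f
  have WP: "W (P f) = W f + W (U f)" and WQ: "W (Q f) = W f - W (U f)" for f
    by (simp_all add: W_def P_def Q_def assemble_add assemble_diff)
  have reindex: "(\<Sum>k<n. F (\<sigma> k)) = (\<Sum>k<n. F k)" for F :: "nat \<Rightarrow> 'x::comm_monoid_add"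
    by (rule sum.reindex_bij_witness[of _ \<sigma> \<sigma>]) (use \<sigma> in auto)
  have cnj\<phi>: "cnj (\<phi> k) = \<phi> (\<sigma> k)" if "k < n" for k
  proof -
    have "cnj (\<phi> k) * \<phi> k = 1"
      using \<phi>(2)[of k] by (simp add: mult.commute complex_norm_square[symmetric])
    then show ?thesis using \<phi>(1)[OF that] by (metis mult.assoc mult.left_neutral mult.right_neutral)
  qed
  have ampl: "cinner (W f) (blinfun_apply (tensor_op t id_blinfun A) (W g))
      = (\<Sum>k<n. cinner (f k) (blinfun_apply A (g k)))" if A: "A \<in> bounded_ops" for f g A
  proof -
    have "blinfun_apply (tensor_op t id_blinfun A) (W g) = W (\<lambda>k. blinfun_apply A (g k))"
      by (simp add: W_def assemble_def blinfun.sum_right tensor_op_id[OF A])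
    then show ?thesis by (simp add: W_def cinner_assemble[OF orth])
  qed
  \<comment> \<open>This identity and the next express that the self-adjoint unitary
    \<open>U\<close> commutes with \<open>I \<otimes> A\<close>. They make the cross terms of
    \<open>P\<close> and \<open>Q\<close> cancel.\<close>
  have UU: "(\<Sum>k<n. cinner (U f k) (blinfun_apply A (U g k))) = (\<Sum>k<n. cinner (f k) (blinfun_apply A (g k)))"
    if A: "A \<in> bounded_ops" for f g A
  proof -
    have "cinner (U f k) (blinfun_apply A (U g k)) = cinner (f (\<sigma> k)) (blinfun_apply A (g (\<sigma> k)))"
      if "k < n" for k
      using \<phi>(1)[OF that]
      by (simp add: U_def bounded_opsD[OF A] cinner_scaleC_left cinner_scaleC_right cnj\<phi>[OF that]
          mult.assoc[symmetric])
    then show ?thesis using reindex[of "\<lambda>k. cinner (f k) (blinfun_apply A (g k))"] by simp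
  qed
  have U1: "(\<Sum>k<n. cinner (U f k) (blinfun_apply A (g k))) = (\<Sum>k<n. cinner (f k) (blinfun_apply A (U g k)))"
    if A: "A \<in> bounded_ops" for f g A
  proof -
    have "(\<Sum>k<n. cinner (U f k) (blinfun_apply A (g k)))
        = (\<Sum>k<n. cinner (U f (\<sigma> k)) (blinfun_apply A (g (\<sigma> k))))"
      by (rule reindex[symmetric])
    also have "\<dots> = (\<Sum>k<n. cinner (f k) (blinfun_apply A (U g k)))"
      by (intro sum.cong refl)
        (simp add: U_def bounded_opsD[OF A] cinner_scaleC_left cinner_scaleC_right cnj\<phi> \<sigma>)
    finally show ?thesis .
  qed
  have normU: "norm (W (U f)) = norm (W f)" for f
  proof -
    have "(norm (W (U f)))\<^sup>2 = (\<Sum>k<n. (norm (f (\<sigma> k)))\<^sup>2)"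
      unfolding W_def norm_assemble[OF orth] by (simp add: U_def norm_scaleC \<phi>)
    also have "\<dots> = (norm (W f))\<^sup>2"
      unfolding W_def norm_assemble[OF orth] by (rule reindex)
    finally show ?thesis by simp
  qed
  \<comment> \<open>Parallelogram law, \<open>U\<close> being isometric.\<close>
  have norm2: "(norm (W (P f)))\<^sup>2 + (norm (W (Q f)))\<^sup>2 = 4 * (norm (W f))\<^sup>2" for f
    unfolding WP WQ parallelogram normU by simp
  have PQ: "cmod (cinner (W (P f)) (blinfun_apply T (W (Q g)))) \<le> b * norm (W (P f)) * norm (W (Q g))" for f g
  proof (rule T)
    fix A assume A: "A \<in> (bounded_ops :: ('h \<Rightarrow>\<^sub>L 'h) set)"
    show "cinner (W (P f)) (blinfun_apply (tensor_op t id_blinfun A) (W (Q g))) = 0"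
      unfolding WP WQ blinfun.diff_right cinner_add_left cinner.diff_right
      by (simp add: ampl[OF A] UU[OF A] U1[OF A])
  qed
  have QP: "cmod (cinner (W (Q f)) (blinfun_apply T (W (P g)))) \<le> b * norm (W (Q f)) * norm (W (P g))" for f g
  proof (rule T)
    fix A assume A: "A \<in> (bounded_ops :: ('h \<Rightarrow>\<^sub>L 'h) set)"
    show "cinner (W (Q f)) (blinfun_apply (tensor_op t id_blinfun A) (W (P g))) = 0"
      unfolding WP WQ blinfun.add_right cinner_add_right cinner.diff_left
      by (simp add: ampl[OF A] UU[OF A] U1[OF A])
  qed
  define D where "D = cinner (W f) (blinfun_apply T (W g)) - cinner (W (U f)) (blinfun_apply T (W (U g)))"
  \<comment> \<open>With \<open>P = 1 + U\<close> and \<open>Q = 1 - U\<close> this is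
    \<open>P T Q + Q T P = 2 (T - U T U)\<close>.\<close>
  have "2 * D = cinner (W (P f)) (blinfun_apply T (W (Q g))) + cinner (W (Q f)) (blinfun_apply T (W (P g)))"
    unfolding WP WQ D_def
    by (simp add: blinfun.add_right blinfun.diff_right cinner_add_left cinner_add_right
        cinner.diff_left cinner.diff_right)
  then have "2 * cmod D \<le> b * norm (W (P f)) * norm (W (Q g)) + b * norm (W (Q f)) * norm (W (P g))"
    using norm_triangle_le[OF add_mono[OF PQ QP]] by (metis norm_mult norm_numeral)
  also have "\<dots> = b * (norm (W (P f)) * norm (W (Q g)) + norm (W (Q f)) * norm (W (P g)))"
    by (simp add: algebra_simps)
  also have "\<dots> \<le> b * (4 * (norm (W f) * norm (W g)))"
  proof (intro mult_left_mono b)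
    \<comment> \<open>Cauchy-Schwarz in the plane, so that the two off-diagonal corners together
      cost no more than one.\<close>
    have "(norm (W (P f)) * norm (W (Q g)) + norm (W (Q f)) * norm (W (P g)))\<^sup>2
        \<le> ((norm (W (P f)))\<^sup>2 + (norm (W (Q f)))\<^sup>2) * ((norm (W (P g)))\<^sup>2 + (norm (W (Q g)))\<^sup>2)"
    proof -
      have "(p * q' + q * p')\<^sup>2 + (p * p' - q * q')\<^sup>2 = (p\<^sup>2 + q\<^sup>2) * (p'\<^sup>2 + q'\<^sup>2)" for p q p' q' :: real
        by (simp add: algebra_simps power2_eq_square)
      then show ?thesis by (metis le_add_same_cancel1 zero_le_power2)
    qed
    also have "\<dots> = (4 * (norm (W f) * norm (W g)))\<^sup>2"
      unfolding norm2 by (simp add: power2_eq_square)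
    finally show "norm (W (P f)) * norm (W (Q g)) + norm (W (Q f)) * norm (W (P g))
        \<le> 4 * (norm (W f) * norm (W g))"
      by (rule power2_le_imp_le) simp
  qed
  finally show ?thesis by (simp add: D_def U_def W_def mult_ac)
qed

text \<open>The differences bounded by \<open>symmetry_estimate\<close> are averaged over all
  \<open>a\<close> and \<open>b\<close>: the phases remove the off-diagonal blocks, and the
  reflections spread each diagonal block over all coordinates.\<close>

lemma averaging_estimate:
  assumes orth: "orthonormal n e" and b: "0 \<le> b" and Top: "T \<in> bounded_ops"
    and T: "\<And>x z. (\<And>A. A \<in> bounded_ops \<Longrightarrow>
        cinner z (blinfun_apply (tensor_op t id_blinfun A) x) = 0) \<Longrightarrow>
        cmod (cinner z (blinfun_apply T x)) \<le> b * norm z * norm x"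
  shows "cmod (cinner (assemble n e f) (blinfun_apply T (assemble n e g))
      - (\<Sum>i<n. (\<Sum>k<n. cinner (t (e k) (f i)) (blinfun_apply T (t (e k) (g i)))) / of_nat n))
    \<le> (if n = 2 then 3 / 2 else 2) * b * norm (assemble n e f) * norm (assemble n e g)"
proof (cases "n = 0")
  case True
  then show ?thesis by (simp add: assemble_def cinner.zero_left)
next
  case False
  then have n: "0 < n" by simp
  define W where "W = assemble n e"
  define U where "U a b f = (\<lambda>k. phase n a b k *\<^sub>C f (reflect n a k))" for a b and f :: "nat \<Rightarrow> 'h"
  define Z where "Z = cinner (W f) (blinfun_apply T (W g))"
  define Y where "Y a b = cinner (W (U a b f)) (blinfun_apply T (W (U a b g)))" for a b
  define B where "B k l x y = cinner (t (e k) x) (blinfun_apply T (t (e l) y))" for k l x y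
  define S where "S = (\<Sum>i<n. \<Sum>k<n. B k k (f i) (g i))"
  define c :: real where "c = (if n = 2 then 3 / 2 else 2)"
  have Y: "Y a b = (\<Sum>k<n. \<Sum>l<n. (cnj (phase n a b k) * phase n a b l)
      * B k l (f (reflect n a k)) (g (reflect n a l)))" for a b
    unfolding Y_def W_def U_def assemble_def blinfun.sum_right cinner.sum_left
    unfolding cinner.sum_right
    by (simp add: t_scaleC bounded_opsD[OF Top] cinner_scaleC_left cinner_scaleC_right B_def mult_ac)
  \<comment> \<open>By \<open>sum_phase\<close>, summing over \<open>b\<close> kills all blocks with
    \<open>k \<noteq> l\<close>.\<close>
  have "(\<Sum>b<n. Y a b) = of_nat n * (\<Sum>k<n. B k k (f (reflect n a k)) (g (reflect n a k)))" for a
  proof -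
    have "(\<Sum>b<n. Y a b) = (\<Sum>k<n. \<Sum>b<n. \<Sum>l<n. (cnj (phase n a b k) * phase n a b l)
        * B k l (f (reflect n a k)) (g (reflect n a l)))"
      unfolding Y by (rule sum.swap)
    also have "\<dots> = (\<Sum>k<n. \<Sum>l<n. \<Sum>b<n. (cnj (phase n a b k) * phase n a b l)
        * B k l (f (reflect n a k)) (g (reflect n a l)))"
      by (intro sum.cong refl sum.swap)
    also have "\<dots> = (\<Sum>k<n. \<Sum>l<n. if k = l
        then of_nat n * B k k (f (reflect n a k)) (g (reflect n a k)) else 0)"
      unfolding sum_distrib_right[symmetric] by (intro sum.cong refl) (auto simp: sum_phase)
    also have "\<dots> = of_nat n * (\<Sum>k<n. B k k (f (reflect n a k)) (g (reflect n a k)))"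
      by (simp add: sum_distrib_left)
    finally show ?thesis .
  qed
  then have "(\<Sum>a<n. \<Sum>b<n. Y a b)
      = of_nat n * (\<Sum>a<n. \<Sum>k<n. B k k (f (reflect n a k)) (g (reflect n a k)))"
    by (simp add: sum_distrib_left)
  also have "(\<Sum>a<n. \<Sum>k<n. B k k (f (reflect n a k)) (g (reflect n a k)))
      = (\<Sum>k<n. \<Sum>a<n. B k k (f (reflect n a k)) (g (reflect n a k)))"
    by (rule sum.swap)
  \<comment> \<open>For fixed \<open>k\<close>, the diagonal block \<open>k\<close> meets every
    coordinate \<open>i\<close> exactly once as \<open>a\<close> varies.\<close>
  also have "\<dots> = (\<Sum>k<n. \<Sum>i<n. B k k (f i) (g i))"
    using sum_reflect[where F = "\<lambda>i. B k k (f i) (g i)" for k] by (rule sum.cong[OF refl]) simp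
  also have "\<dots> = S" unfolding S_def by (rule sum.swap)
  finally have YS: "(\<Sum>a<n. \<Sum>b<n. Y a b) = of_nat n * S" .
  define K where "K = b * norm (W f) * norm (W g)"
  have est: "cmod (Z - Y a b') \<le> 2 * K" if "a < n" for a b'
  proof -
    have "cmod (Z - Y a b') \<le> 2 * b * norm (W f) * norm (W g)"
      unfolding Z_def Y_def W_def U_def
      by (rule symmetry_estimate[OF orth b T])
        (use that in \<open>auto simp: reflect_less reflect_reflect phase_reflect norm_phase\<close>)
    then show ?thesis by (simp add: K_def mult_ac)
  qed
  have "cmod (\<Sum>a<n. \<Sum>b'<n. Z - Y a b') \<le> (real n)\<^sup>2 * (c * K)"
  proof (cases "n = 2")
    case True
    \<comment> \<open>Modulo 2, \<open>k\<close> and \<open>-k\<close> agree, so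
      \<open>U 0 0\<close> is the identity. Three of the four differences remain, and
      \<open>3 * 2 = 4 * (3 / 2)\<close>.\<close>
    have "W (U 0 0 f) = W f" for f
      by (simp add: W_def U_def assemble_def True numeral_2_eq_2 phase_def reflect_def scaleC_one)
    then have "Z - Y 0 0 = 0" by (simp add: Z_def Y_def)
    then have "(\<Sum>a<n. \<Sum>b'<n. Z - Y a b') = (Z - Y 0 1) + (Z - Y 1 0) + (Z - Y 1 1)"
      by (simp add: True numeral_2_eq_2)
    also have "cmod \<dots> \<le> 2 * K + 2 * K + 2 * K"
      by (intro norm_triangle_le add_mono est) (simp_all add: True)
    finally show ?thesis by (simp add: True c_def)
  next
    case False
    have "cmod (\<Sum>a<n. \<Sum>b'<n. Z - Y a b') \<le> (\<Sum>a<n. \<Sum>b'<n. 2 * K)"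
      by (intro sum_norm_le est) simp
    then show ?thesis using False by (simp add: c_def power2_eq_square)
  qed
  also have "(\<Sum>a<n. \<Sum>b'<n. Z - Y a b') = of_nat n * (of_nat n * Z - S)"
    using YS by (simp add: sum_subtractf algebra_simps)
  also have "\<dots> = of_nat n * of_nat n * (Z - S / of_nat n)"
    using n by (simp add: field_simps)
  finally have "(real n)\<^sup>2 * cmod (Z - S / of_nat n) \<le> (real n)\<^sup>2 * (c * K)"
    by (simp add: norm_mult power2_eq_square)
  then have "cmod (Z - S / of_nat n) \<le> c * K" using n by simp
  then show ?thesis
    by (simp add: Z_def S_def B_def W_def c_def K_def sum_divide_distrib mult.assoc)
qed

text \<open>The block averages of \<open>T\<close> over the systems \<open>e X\<close> are bounded
  by \<open>norm T\<close> and cluster at some \<open>I \<otimes> A\<close>. The averaging estimate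
  passes to the limit on algebraic tensors and then extends by density.\<close>

lemma distance_constant_le:
  fixes n :: "'l set \<Rightarrow> nat" and e :: "'l set \<Rightarrow> nat \<Rightarrow> 'l"
  assumes orth: "\<And>X. orthonormal (n X) (e X)"
    and span: "\<And>X v. finite X \<Longrightarrow> v \<in> X \<Longrightarrow> v = (\<Sum>i<n X. cinner (e X i) v *\<^sub>C e X i)"
    and c: "\<And>X. (if n X = 2 then 3 / 2 else 2) \<le> c"
  shows "distance_constant (scalar_tensor_ops t) \<le> ennreal c"
proof -
  have c1: "1 \<le> c" using c[of undefined] by (auto split: if_splits)
  have "ennreal (infdist T (scalar_tensor_ops t)) \<le> ennreal c * dist_beta (scalar_tensor_ops t) T"
    if Top: "T \<in> bounded_ops" for T
  proof (cases "dist_beta (scalar_tensor_ops t) T")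
    case top
    then show ?thesis using c1 by (simp add: ennreal_mult_top)
  next
    case (real b)
    \<comment> \<open>The form of the mean of the diagonal blocks of \<open>T\<close>; it is
      \<open>0\<close> for the empty system.\<close>
    define a where "a X h' h
        = (\<Sum>k<n X. cinner (t (e X k) h') (blinfun_apply T (t (e X k) h))) / of_nat (n X)" for X h' h
    have a_bdd: "cmod (a X h' h) \<le> norm T * norm h' * norm h" for X h' h
    proof (cases "n X = 0")
      case False
      have "cmod (cinner (t (e X k) h') (blinfun_apply T (t (e X k) h))) \<le> norm T * norm h' * norm h"
        if "k < n X" for k
      proof -
        have "complex_of_real ((norm (e X k))\<^sup>2) = 1"
          using orth[of X] that unfolding cinner_self[symmetric] by (simp add: orthonormal_def)
        then have "(norm (e X k))\<^sup>2 = 1" using of_real_eq_1_iff by blast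
        then have "norm (e X k) = 1"
          using norm_ge_zero power2_eq_1_iff[of "norm (e X k)"] by (metis abs_norm_cancel abs_1 abs_minus)
        then show ?thesis
          using order_trans[OF cauchy_schwarz mult_left_mono[OF norm_blinfun norm_ge_zero],
              of "t (e X k) h'" T "t (e X k) h"]
          by (simp add: norm_t mult_ac)
      qed
      then have "cmod (\<Sum>k<n X. cinner (t (e X k) h') (blinfun_apply T (t (e X k) h)))
          \<le> (\<Sum>k<n X. norm T * norm h' * norm h)"
        by (intro sum_norm_le) simp
      then show ?thesis using False by (simp add: a_def norm_divide field_simps)
    qed (simp add: a_def)
    obtain R G A where R: "R \<in> bounded_ops" and G: "G \<noteq> bot" "G \<le> finite_subsets_at_top UNIV"
      and lim: "\<And>x y. ((\<lambda>X. \<Sum>i<n X. a X (slice (e X i) x) (slice (e X i) y))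
           \<longlongrightarrow> cinner x (blinfun_apply R y)) G"
      and A: "A \<in> bounded_ops" "\<And>v h. blinfun_apply R (t v h) = t v (blinfun_apply A h)"
    proof (rule amplified_forms_cluster[of n e a "norm T"])
    qed (use orth span a_bdd Top in \<open>auto simp: a_def t.add_right t_scaleC blinfun.add_right
        bounded_opsD cinner_add_left cinner_add_right cinner_scaleC_left cinner_scaleC_right
        sum.distrib add_divide_distrib sum_distrib_left\<close>)
    have RS: "R \<in> scalar_tensor_ops t"
      using tensor_op_eqI[OF R A(2)] A(1) by (auto simp: scalar_tensor_ops_def)
    have rep: "\<forall>\<^sub>F X in finite_subsets_at_top UNIV. x = assemble (n X) (e X) (\<lambda>i. slice (e X i) x)"
      if "x \<in> algebraic_tensors" for x
      by (rule eventually_assemble_slices[OF _ that], rule span)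
    have averaging: "cmod (cinner (assemble (n X) (e X) f) (blinfun_apply T (assemble (n X) (e X) g))
          - (\<Sum>i<n X. a X (f i) (g i)))
        \<le> (if n X = 2 then 3 / 2 else 2) * b * norm (assemble (n X) (e X) f)
          * norm (assemble (n X) (e X) g)" for X f g
      unfolding a_def
      by (rule averaging_estimate[OF orth real(1) Top], rule dist_beta_estimate[OF real(2,1)])
    have alg: "cmod (cinner x (blinfun_apply (T - R) y)) \<le> c * b * norm x * norm y"
      if x: "x \<in> algebraic_tensors" and y: "y \<in> algebraic_tensors" for x y
    proof -
      define r where "r X = (\<Sum>i<n X. a X (slice (e X i) x) (slice (e X i) y))" for X
      \<comment> \<open>For large \<open>X\<close> both tensors are assembled from their slices, so
        the averaging estimate applies to them exactly.\<close>
      have "\<forall>\<^sub>F X in finite_subsets_at_top UNIV.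
          cmod (cinner x (blinfun_apply T y) - r X) \<le> c * b * norm x * norm y"
        using rep[OF x] rep[OF y]
      proof eventually_elim
        case (elim X)
        have "cmod (cinner x (blinfun_apply T y) - r X)
            \<le> (if n X = 2 then 3 / 2 else 2) * b * norm x * norm y"
          using averaging[of X "\<lambda>i. slice (e X i) x" "\<lambda>i. slice (e X i) y"]
          unfolding elim(1)[symmetric] elim(2)[symmetric] r_def .
        also have "\<dots> \<le> c * b * norm x * norm y"
          by (intro mult_right_mono c real) auto
        finally show ?case .
      qed
      then have ev: "\<forall>\<^sub>F X in G. cmod (cinner x (blinfun_apply T y) - r X) \<le> c * b * norm x * norm y"
        using G(2) filter_leD by blast
      have "((\<lambda>X. cmod (cinner x (blinfun_apply T y) - r X))
          \<longlongrightarrow> cmod (cinner x (blinfun_apply T y) - cinner x (blinfun_apply R y))) G"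
        unfolding r_def by (intro tendsto_intros lim)
      from tendsto_upperbound[OF this ev G(1)] show ?thesis
        by (simp add: blinfun.diff_left cinner.diff_right)
    qed
    \<comment> \<open>Density is used one argument at a time, first in \<open>x\<close> and then in
      \<open>y\<close>.\<close>
    have half: "cmod (cinner x (blinfun_apply (T - R) y)) \<le> c * b * norm x * norm y"
      if y: "y \<in> algebraic_tensors" for x y
      by (rule dense_induct[of "\<lambda>x. cmod (cinner x (blinfun_apply (T - R) y)) \<le> c * b * norm x * norm y"])
        (auto intro!: closed_Collect_le continuous_intros cinner.continuous_on alg y)
    have all: "cmod (cinner x (blinfun_apply (T - R) y)) \<le> c * b * norm x * norm y" for x y
      by (rule dense_induct[of "\<lambda>y. cmod (cinner x (blinfun_apply (T - R) y)) \<le> c * b * norm x * norm y"])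
        (auto intro!: closed_Collect_le continuous_intros cinner.continuous_on
          blinfun.continuous_on half)
    have cb: "0 \<le> c * b" using c1 real by simp
    have "norm (T - R) \<le> c * b"
    proof (rule norm_blinfun_bound[OF cb])
      fix y
      \<comment> \<open>Testing the form against this vector itself turns the form bound into a norm
        bound.\<close>
      let ?x = "blinfun_apply (T - R) y"
      have "norm ?x * norm ?x = cmod (cinner ?x ?x)"
        by (simp add: cinner_self norm_mult power2_eq_square)
      also have "\<dots> \<le> c * b * norm ?x * norm y" by (rule all)
      finally have "norm ?x * norm ?x \<le> norm ?x * (c * b * norm y)" by (simp add: mult_ac)
      then show "norm ?x \<le> c * b * norm y"
        using cb by (cases "norm ?x = 0") (auto simp: mult_le_cancel_left_pos)
    qed
    then have "infdist T (scalar_tensor_ops t) \<le> c * b"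
      using infdist_le[OF RS, of T] by (simp add: dist_norm)
    then show ?thesis
      using real c1 by (simp add: ennreal_leI flip: ennreal_mult)
  qed
  then show ?thesis
    unfolding distance_constant_def using c1 by (intro Inf_lower) auto
qed

end

section \<open>The two distance constants\<close>

theorem proposition6p9:
  fixes t :: "'l::chilbert_space \<Rightarrow> 'h::chilbert_space \<Rightarrow> 'k::chilbert_space"
    and u :: "complex ^ 2 \<Rightarrow> 'h \<Rightarrow> 'm::chilbert_space"
  shows "(hilbert_tensor t \<longrightarrow> distance_constant (scalar_tensor_ops t) \<le> 2) \<and>
    (hilbert_tensor u \<longrightarrow> distance_constant (scalar_tensor_ops u) \<le> ennreal (3 / 2))"
proof (intro conjI impI)
  assume "hilbert_tensor t"
  then interpret tensor_product t by unfold_locales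
  obtain n e where orth: "\<And>X::'l set. orthonormal (n X) (e X)"
    and span: "\<And>X v. finite X \<Longrightarrow> v \<in> X \<Longrightarrow> v = (\<Sum>i<n X. cinner (e X i) v *\<^sub>C e X i)"
    by (rule exhausting_orthonormal_systems, rule that)
  \<comment> \<open>The sizes of the systems vary with \<open>X\<close>; the constant 2 covers them
    all.\<close>
  have "distance_constant (scalar_tensor_ops t) \<le> ennreal 2"
    by (rule distance_constant_le[OF orth span]) auto
  then show "distance_constant (scalar_tensor_ops t) \<le> 2" by simp
next
  assume "hilbert_tensor u"
  then interpret tensor_product u by unfold_locales
  \<comment> \<open>The standard basis of the plane serves every index \<open>X\<close>, so the
    systems always have size 2 and the better constant holds.\<close>
  define e :: "nat \<Rightarrow> complex ^ 2" where "e i = axis (if i = 0 then 1 else 2) 1" for i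
  have "orthonormal 2 e"
    by (auto simp: orthonormal_def e_def cinner_vec_def sum_2 axis_def cinner_complex_def)
  moreover have "v = (\<Sum>i<2. cinner (e i) v *\<^sub>C e i)" for v
    by (simp add: vec_eq_iff forall_2 numeral_2_eq_2 e_def cinner_vec_def sum_2 axis_def
        cinner_complex_def scaleC_vec_def scaleC_complex_def)
  ultimately show "distance_constant (scalar_tensor_ops u) \<le> ennreal (3 / 2)"
    by (intro distance_constant_le[of "\<lambda>_. 2" "\<lambda>_. e"]) auto
qed

end
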